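(* Let $\epsilon>0$ be given, and consider the inexact augmented Lagrangian method (Method A) described in the context, applied to the convex conic program described there. Suppose that $\{\rho_k\}$ and $\{\eta_k\}$ are chosen as $$\rho_k=\rho_0(k+1)^{3/2},\qquad \eta_k=\eta_0(k+1)^{-5/2}\cdot\min\{1,\sqrt\epsilon\}$$ for some $\rho_0\ge1$ and $0<\eta_0\le1$. Then the total number of inner iterations of Method A for finding an $\epsilon$-KKT solution of the conic program is at most $\mathcal O\big(\mathcal T(\min\{1,\epsilon\})\big)$ (the constant hidden in $\mathcal O$ depending only on $\rho_0,\eta_0$), where $$\mathcal T(t)=\frac{D_X\bar D_\Lambda^{3/2}\bar C}{t^{7/4}}+\frac{D_X\bar D_\Lambda^{5/4}\bar B^{1/2}(1+L_{\nabla g}^{1/2})}{t^{11/8}}+\frac{D_X\bar D_\Lambda^{1/4}(L_{\nabla g}+L_{\nabla g}^{1/2})}{t^{9/8}}+\frac{D_X\bar B}{t}+\frac{\bar D_\Lambda^{1/2}}{t^{1/2}}.$$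
   Context: **Problem.** Consider $$F^*=\min\{F(x):=f(x)+P(x)\;:\; g(x)\preceq_{\mathcal K}0\},$$ where $f,P:\mathbb R^n\to(-\infty,\infty]$ are proper closed convex, $\mathcal K\subseteq\mathbb R^m$ is a closed convex cone, $y\preceq_{\mathcal K}z$ means $z-y\in\mathcal K$, and $g:\mathbb R^n\to\mathbb R^m$ is $\mathcal K$-convex: $g(\alpha x+(1-\alpha)y)\preceq_{\mathcal K}\alpha g(x)+(1-\alpha)g(y)$ for all $x,y\in\mathbb R^n$, $\alpha\in[0,1]$. Let $\mathcal K^*=\{y:\langle y,x\rangle\ge0\ \forall x\in\mathcal K\}$. The Lagrangian dual problem is $d^*=\sup_{\lambda\in\mathcal K^*}\inf_x\{f(x)+P(x)+\langle\lambda,g(x)\rangle\}$. **Standing assumptions.** (a) The proximal operator of $P$ can be evaluated exactly and $\mathrm{dom}(P)$ is compact. (b) The projection onto $\mathcal K$ can be evaluated exactly. (c) $f$ and $g$ are continuously differentiable on an open set $\Omega\supseteq\mathrm{dom}(P)$, and $\nabla f$, $\nabla g$ are Lipschitz on $\Omega$ with constants $L_{\nabla f}$, $L_{\nabla g}$ ($\nabla g$ is the transpose of the Jacobian of $g$). (d) Strong duality holds: primal and dual problems both have optimal solutions and $F^*=d^*$. **Notation.** $\|\cdot\|$ is the Euclidean norm, $\Pi_C$ the projection onto a closed convex set $C$, $\mathrm{dist}$ the Euclidean distance, $\mathcal N_C$ the normal cone of $C$, $\mathrm{prox}_h(z)=\arg\min_x\{\frac12\|x-z\|^2+h(x)\}$.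 For $\rho>0$, $$\mathcal S(x,\lambda;\rho)=f(x)+\tfrac1{2\rho}\mathrm{dist}^2(\lambda+\rho g(x),-\mathcal K),\qquad \mathcal L(x,\lambda;\rho)=\mathcal S(x,\lambda;\rho)+P(x)-\tfrac{\|\lambda\|^2}{2\rho}.$$ $L_g$ is the Lipschitz constant of $g$ on $\mathrm{dom}(P)$ and $M_g=\max_{x\in\mathrm{dom}(P)}\|g(x)\|$. $\Lambda^*$ is the set of optimal solutions of the dual problem, $\hat\lambda^*\in\Lambda^*$ satisfies $\|\lambda^0-\hat\lambda^*\|=\mathrm{dist}(\lambda^0,\Lambda^* )$, and $$D_X=\max_{x,y\in\mathrm{dom}(P)}\|x-y\|,\quad D_\Lambda=\|\lambda^0-\hat\lambda^*\|,\quad B=L_{\nabla f}+L_{\nabla g}(\|\hat\lambda^*\|+D_\Lambda),\quad C=L_{\nabla g}M_g+L_g^2,$$ $$\bar D_\Lambda=\max\{D_\Lambda,1\},\quad \bar B=\max\{B,1\},\quad \bar C=\max\{C,1\}.$$ **$\epsilon$-KKT solution.** $(x,\lambda)$ is an $\epsilon$-KKT solution if $x\in\mathrm{dom}(P)$, $\lambda\in\mathcal K^*$, $\mathrm{dist}(0,\nabla f(x)+\partial P(x)+\nabla g(x)\lambda)\le\epsilon$ and $\mathrm{dist}(g(x),\mathcal N_{\mathcal K^*}(\lambda))\le\epsilon$. **Inner method** for $\min_x\{\phi(x)+h(x)\}$, with $\phi$ convex and $\nabla\phi$ Lipschitz with constant $L_{\nabla\phi}$ on $\mathrm{dom}(h)$: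 start from $x^0=z^0\in\mathrm{dom}(h)$; for $k=0,1,\dots$ set $y^k=(kx^k+2z^k)/(k+2)$, $z^{k+1}=\arg\min_z\{\phi(y^k)+\langle\nabla\phi(y^k),z-y^k\rangle+h(z)+\frac{L_{\nabla\phi}}{k+2}\|z-z^k\|^2\}$, $x^{k+1}=(kx^k+2z^{k+1})/(k+2)$. To minimize $\mathcal L(\cdot,\lambda;\rho)$ it is applied (up to an additive constant) with $\phi=\mathcal S(\cdot,\lambda;\rho)$, $h=P$, and $L_{\nabla\phi}=L_{\nabla f}+L_{\nabla g}(\|\lambda\|+\rho M_g)+\rho L_g^2$, and is run until an iterate with the required accuracy is found. **Method A.** Input $\epsilon>0$, $\lambda^0\in\mathcal K^*$, nondecreasing $\{\rho_k\}\subset(0,\infty)$, and $0<\eta_k\downarrow0$. Set $k=0$. 1. Apply the inner method to $\min_x\mathcal L(x,\lambda^k;\rho_k)$ to find $x^{k+1}\in\mathrm{dom}(P)$ with $\mathcal L(x^{k+1},\lambda^k;\rho_k)-\min_x\mathcal L(x,\lambda^k;\rho_k)\le\eta_k$. 2. Set $\lambda^{k+1}=\Pi_{\mathcal K^*}(\lambda^k+\rho_kg(x^{k+1}))$. 3. If $(x^{k+1},\lambda^{k+1})$ is an $\epsilon$-KKT solution, output $(x^+,\lambda^+)=(x^{k+1},\lambda^{k+1})$ and terminate. 4. If $\frac1{\rho_k}\|\lambda^{k+1}-\lambda^k\|\le\frac34\epsilon$ and $\frac{\eta_k}{\rho_k}\le\frac{\epsilon^2}{128}$, output $(x^+,\lambda^+)=\mathrm{Postprocessing}(\lambda^k,\rho_k,x^{k+1},\epsilon)$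 and terminate. 5. Set $k\leftarrow k+1$ and go to Step 1. **Subroutine $\mathrm{Postprocessing}(\tilde\lambda,\tilde\rho,\tilde x,\epsilon)$.** Set $\tilde L=L_{\nabla f}+L_{\nabla g}(\|\tilde\lambda\|+\tilde\rho M_g)+\tilde\rho L_g^2$ and $\tilde\eta=\epsilon^2\min\{\tilde\rho/128,\,1/(8\tilde L)\}$. Apply the inner method to $\min_x\mathcal L(x,\tilde\lambda;\tilde\rho)$, starting with $\tilde x$, to find $\hat x$ with $\mathcal L(\hat x,\tilde\lambda;\tilde\rho)-\min_x\mathcal L(x,\tilde\lambda;\tilde\rho)\le\tilde\eta$. Output $$x^+=\mathrm{prox}_{P/\tilde L}\big(\hat x-\nabla_x\mathcal S(\hat x,\tilde\lambda;\tilde\rho)/\tilde L\big),\qquad \lambda^+=\Pi_{\mathcal K^*}(\tilde\lambda+\tilde\rho g(x^+)).$$ The inner iterations of Method A are all the iterations of the inner method performed in Step 1 over all $k$ and in the Postprocessing subroutine. *)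

theory Defs
  imports "HOL-Analysis.Analysis"
begin

definition edom :: "('a \<Rightarrow> ereal) \<Rightarrow> 'a set" where
  "edom h = {x. h x < \<infinity>}"

definition ereal_epigraph :: "('a \<Rightarrow> ereal) \<Rightarrow> ('a \<times> real) set" where
  "ereal_epigraph h = {(x, r). h x \<le> ereal r}"

definition proper_closed_convex :: "('a::euclidean_space \<Rightarrow> ereal) \<Rightarrow> bool" where
  "proper_closed_convex h \<longleftrightarrow>
     (\<forall>x. h x \<noteq> -\<infinity>) \<and> (\<exists>x. h x \<noteq> \<infinity>) \<and>
     closed (ereal_epigraph h) \<and> convex (ereal_epigraph h)"

definition subdifferential :: "('a::real_inner \<Rightarrow> ereal) \<Rightarrow> 'a \<Rightarrow> 'a set" where
  "subdifferential h x = {v. \<forall>y. h x + ereal (v \<bullet> (y - x)) \<le> h y}"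

definition normal_cone :: "'a::real_inner set \<Rightarrow> 'a \<Rightarrow> 'a set" where
  "normal_cone S x = {v. x \<in> S \<and> (\<forall>y\<in>S. v \<bullet> (y - x) \<le> 0)}"

definition dual_cone :: "'b::real_inner set \<Rightarrow> 'b set" where
  "dual_cone K = {y. \<forall>x\<in>K. 0 \<le> y \<bullet> x}"

definition cone_le :: "'b::real_vector set \<Rightarrow> 'b \<Rightarrow> 'b \<Rightarrow> bool" where
  "cone_le K y z \<longleftrightarrow> z - y \<in> K"

definition cone_convex :: "'b::real_vector set \<Rightarrow> ('a::real_vector \<Rightarrow> 'b) \<Rightarrow> bool" where
  "cone_convex K g \<longleftrightarrow>
     (\<forall>x y. \<forall>\<alpha>\<in>{0..1}.
        cone_le K (g (\<alpha> *\<^sub>R x + (1 - \<alpha>) *\<^sub>R y)) (\<alpha> *\<^sub>R g x + (1 - \<alpha>) *\<^sub>R g y))"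

text \<open>The gradient of an extended-valued function, for use at interior points of its domain.\<close>

definition grad :: "('a::real_inner \<Rightarrow> ereal) \<Rightarrow> 'a \<Rightarrow> 'a" where
  "grad h x = (THE D. GDERIV (\<lambda>y. real_of_ereal (h y)) x :> D)"

text \<open>The transpose of the Jacobian, as a linear map in coordinate-free form.\<close>

definition grad_map :: "('a::euclidean_space \<Rightarrow> 'b::euclidean_space) \<Rightarrow> 'a \<Rightarrow> 'b \<Rightarrow> 'a" where
  "grad_map g x = adjoint (frechet_derivative g (at x))"

definition cont_diff_fun_on :: "'a::euclidean_space set \<Rightarrow> ('a \<Rightarrow> ereal) \<Rightarrow> bool" where
  "cont_diff_fun_on \<Omega> h \<longleftrightarrow>
     (\<forall>x\<in>\<Omega>. \<bar>h x\<bar> \<noteq> \<infinity> \<and> (\<lambda>y. real_of_ereal (h y)) differentiable (at x)) \<and>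
     continuous_on \<Omega> (grad h)"

definition cont_diff_map_on ::
    "'a::euclidean_space set \<Rightarrow> ('a \<Rightarrow> 'b::euclidean_space) \<Rightarrow> bool" where
  "cont_diff_map_on \<Omega> g \<longleftrightarrow>
     (\<forall>x\<in>\<Omega>. g differentiable (at x)) \<and>
     (\<forall>v. continuous_on \<Omega> (\<lambda>x. frechet_derivative g (at x) v))"

text \<open>Matrices are measured in the operator norm; a constant that is valid for the
  Frobenius norm is in particular valid here.\<close>

definition grad_map_lipschitz_on ::
    "real \<Rightarrow> 'a::euclidean_space set \<Rightarrow> ('a \<Rightarrow> 'b::euclidean_space) \<Rightarrow> bool" where
  "grad_map_lipschitz_on L \<Omega> g \<longleftrightarrow>
     0 \<le> L \<and>
     (\<forall>x\<in>\<Omega>. \<forall>y\<in>\<Omega>. onorm (\<lambda>v. grad_map g x v - grad_map g y v) \<le> L * dist x y)"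

definition is_prox :: "('a::real_inner \<Rightarrow> ereal) \<Rightarrow> 'a \<Rightarrow> 'a \<Rightarrow> bool" where
  "is_prox h z p \<longleftrightarrow> is_arg_min (\<lambda>x. ereal (1 / 2 * (norm (x - z))\<^sup>2) + h x) (\<lambda>_. True) p"

definition near_min :: "('a \<Rightarrow> ereal) \<Rightarrow> real \<Rightarrow> 'a \<Rightarrow> bool" where
  "near_min F \<eta> x \<longleftrightarrow> F x - (INF y. F y) \<le> ereal \<eta>"

text \<open>One iteration, from \<open>(x\<^sup>j, z\<^sup>j)\<close> to \<open>(x\<^sup>j\<^sup>+\<^sup>1, z\<^sup>j\<^sup>+\<^sup>1)\<close>, for minimizing \<open>\<phi> + h\<close>.\<close>

definition inner_step ::
    "('a::real_inner \<Rightarrow> ereal) \<Rightarrow> ('a \<Rightarrow> ereal) \<Rightarrow> real \<Rightarrow> nat \<Rightarrow> 'a \<Rightarrow> 'a \<Rightarrow> 'a \<Rightarrow> 'a \<Rightarrow> bool" where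
  "inner_step \<phi> h L j x z x' z' \<longleftrightarrow>
     (let y = (1 / (real j + 2)) *\<^sub>R (real j *\<^sub>R x + 2 *\<^sub>R z) in
        is_arg_min (\<lambda>w. \<phi> y + ereal (grad \<phi> y \<bullet> (w - y)) + h w
                        + ereal (L / (real j + 2) * (norm (w - z))\<^sup>2)) (\<lambda>_. True) z' \<and>
        x' = (1 / (real j + 2)) *\<^sub>R (real j *\<^sub>R x + 2 *\<^sub>R z'))"

context
  fixes f P :: "'a::euclidean_space \<Rightarrow> ereal"
    and g :: "'a \<Rightarrow> 'b::euclidean_space"
    and K :: "'b set"
begin

definition feasible_set :: "'a set" where
  "feasible_set = {x. cone_le K (g x) 0}"

definition primal_value :: ereal where
  "primal_value = (INF x\<in>feasible_set. f x + P x)"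

definition primal_solutions :: "'a set" where
  "primal_solutions = {x \<in> feasible_set. f x + P x = primal_value}"

definition dual_function :: "'b \<Rightarrow> ereal" where
  "dual_function \<mu> = (INF x. f x + P x + ereal (\<mu> \<bullet> g x))"

definition dual_value :: ereal where
  "dual_value = (SUP \<mu>\<in>dual_cone K. dual_function \<mu>)"

definition dual_solutions :: "'b set" where
  "dual_solutions = {\<mu> \<in> dual_cone K. dual_function \<mu> = dual_value}"

definition strong_duality :: bool where
  "strong_duality \<longleftrightarrow>
     primal_solutions \<noteq> {} \<and> dual_solutions \<noteq> {} \<and> primal_value = dual_value"

definition smooth_part :: "'b \<Rightarrow> real \<Rightarrow> 'a \<Rightarrow> ereal" where
  "smooth_part \<mu> \<rho> x = f x + ereal (1 / (2 * \<rho>) * (infdist (\<mu> + \<rho> *\<^sub>R g x) (uminus ` K))\<^sup>2)"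

definition aug_lagrangian :: "'b \<Rightarrow> real \<Rightarrow> 'a \<Rightarrow> ereal" where
  "aug_lagrangian \<mu> \<rho> x = smooth_part \<mu> \<rho> x + P x - ereal ((norm \<mu>)\<^sup>2 / (2 * \<rho>))"

text \<open>The distance to the empty set is infinite, whereas \<^const>\<open>infdist\<close> is then \<open>0\<close>:
  hence the two non-emptiness conditions.\<close>

definition eps_kkt :: "real \<Rightarrow> 'a \<Rightarrow> 'b \<Rightarrow> bool" where
  "eps_kkt \<epsilon> x \<mu> \<longleftrightarrow>
     x \<in> edom P \<and> \<mu> \<in> dual_cone K \<and>
     (let A = (\<lambda>v. grad f x + v + grad_map g x \<mu>) ` subdifferential P x
      in A \<noteq> {} \<and> infdist 0 A \<le> \<epsilon>) \<and>
     (let A = normal_cone (dual_cone K) \<mu>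
      in A \<noteq> {} \<and> infdist (g x) A \<le> \<epsilon>)"

definition multiplier_update :: "'b \<Rightarrow> real \<Rightarrow> 'a \<Rightarrow> 'b" where
  "multiplier_update \<mu> \<rho> x = closest_point (dual_cone K) (\<mu> + \<rho> *\<^sub>R g x)"

end

text \<open>
  The method is a transition system whose configurations pair the number of inner iterations
  performed so far with one of the following states.
  \<^item> \<open>Main k \<mu> j x z\<close>: the inner method of outer iteration \<open>k\<close>, with multiplier \<open>\<mu>\<close>,
    has performed \<open>j\<close> iterations and has reached \<open>(x, z)\<close>.
  \<^item> \<open>Post \<mu> \<rho> j x z\<close>: the same for the inner method of the postprocessing subroutine.
  \<^item> \<open>Output x \<mu>\<close>: the method has terminated.

  The inner method stops at its first iterate of the required accuracy, \<open>x\<^sup>0\<close> included. In the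
  main loop its starting point is an arbitrary point of the domain of \<open>P\<close>.
\<close>

datatype ('a, 'b) alm_state =
    Main nat 'b nat 'a 'a
  | Post 'b real nat 'a 'a
  | Output 'a 'b

context
  fixes f P :: "'a::euclidean_space \<Rightarrow> ereal"
    and g :: "'a \<Rightarrow> 'b::euclidean_space"
    and K :: "'b set"
    and L_f L_dg L_g M_g :: real
    and \<epsilon> :: real
    and \<rho> \<eta> :: "nat \<Rightarrow> real"
begin

definition smooth_lip :: "'b \<Rightarrow> real \<Rightarrow> real" where
  "smooth_lip \<mu> r = L_f + L_dg * (norm \<mu> + r * M_g) + r * L_g\<^sup>2"

definition small_step :: "nat \<Rightarrow> 'b \<Rightarrow> 'b \<Rightarrow> bool" where
  "small_step k \<mu> \<mu>' \<longleftrightarrow>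
     1 / \<rho> k * norm (\<mu>' - \<mu>) \<le> 3 / 4 * \<epsilon> \<and> \<eta> k / \<rho> k \<le> \<epsilon>\<^sup>2 / 128"

definition post_accuracy :: "'b \<Rightarrow> real \<Rightarrow> real" where
  "post_accuracy \<mu> r = \<epsilon>\<^sup>2 * min (r / 128) (1 / (8 * smooth_lip \<mu> r))"

text \<open>If \<^term>\<open>smooth_lip \<mu> r = 0\<close>, then \<open>1 / 0 = 0\<close> makes the postprocessing accuracy \<open>0\<close>, which
  the inner method attains after at most one iteration (the smooth part is then affine on the
  domain of \<open>P\<close>), and the proximal step is the identity. Writing the scaled function as
  \<^term>\<open>ereal (1 / L) * P y\<close> rather than \<^term>\<open>P y / ereal L\<close> matters only in that case.\<close>

definition prox_grad_step :: "'b \<Rightarrow> real \<Rightarrow> 'a \<Rightarrow> 'a \<Rightarrow> bool" where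
  "prox_grad_step \<mu> r x x' \<longleftrightarrow>
     (let L = smooth_lip \<mu> r in
        is_prox (\<lambda>y. ereal (1 / L) * P y) (x - (1 / L) *\<^sub>R grad (smooth_part f g K \<mu> r) x) x')"

inductive alm_step ::
    "nat \<times> ('a, 'b) alm_state \<Rightarrow> nat \<times> ('a, 'b) alm_state \<Rightarrow> bool" where
  main_inner:
    "\<not> near_min (aug_lagrangian f P g K \<mu> (\<rho> k)) (\<eta> k) x \<Longrightarrow>
     inner_step (smooth_part f g K \<mu> (\<rho> k)) P (smooth_lip \<mu> (\<rho> k)) j x z x' z' \<Longrightarrow>
     alm_step (N, Main k \<mu> j x z) (Suc N, Main k \<mu> (Suc j) x' z')"
| main_output:
    "near_min (aug_lagrangian f P g K \<mu> (\<rho> k)) (\<eta> k) x \<Longrightarrow>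
     \<mu>' = multiplier_update g K \<mu> (\<rho> k) x \<Longrightarrow>
     eps_kkt f P g K \<epsilon> x \<mu>' \<Longrightarrow>
     alm_step (N, Main k \<mu> j x z) (N, Output x \<mu>')"
| main_post:
    "near_min (aug_lagrangian f P g K \<mu> (\<rho> k)) (\<eta> k) x \<Longrightarrow>
     \<mu>' = multiplier_update g K \<mu> (\<rho> k) x \<Longrightarrow>
     \<not> eps_kkt f P g K \<epsilon> x \<mu>' \<Longrightarrow>
     small_step k \<mu> \<mu>' \<Longrightarrow>
     alm_step (N, Main k \<mu> j x z) (N, Post \<mu> (\<rho> k) 0 x x)"
| main_next:
    "near_min (aug_lagrangian f P g K \<mu> (\<rho> k)) (\<eta> k) x \<Longrightarrow>
     \<mu>' = multiplier_update g K \<mu> (\<rho> k) x \<Longrightarrow>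
     \<not> eps_kkt f P g K \<epsilon> x \<mu>' \<Longrightarrow>
     \<not> small_step k \<mu> \<mu>' \<Longrightarrow>
     s \<in> edom P \<Longrightarrow>
     alm_step (N, Main k \<mu> j x z) (N, Main (Suc k) \<mu>' 0 s s)"
| post_inner:
    "\<not> near_min (aug_lagrangian f P g K \<mu> r) (post_accuracy \<mu> r) x \<Longrightarrow>
     inner_step (smooth_part f g K \<mu> r) P (smooth_lip \<mu> r) j x z x' z' \<Longrightarrow>
     alm_step (N, Post \<mu> r j x z) (Suc N, Post \<mu> r (Suc j) x' z')"
| post_output:
    "near_min (aug_lagrangian f P g K \<mu> r) (post_accuracy \<mu> r) x \<Longrightarrow>
     prox_grad_step \<mu> r x x' \<Longrightarrow>
     \<mu>' = multiplier_update g K \<mu> r x' \<Longrightarrow>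
     alm_step (N, Post \<mu> r j x z) (N, Output x' \<mu>')"

text \<open>A maximal execution, made infinite by repeating the last configuration if no further step
  is possible.\<close>

definition alm_execution :: "'b \<Rightarrow> (nat \<Rightarrow> nat \<times> ('a, 'b) alm_state) \<Rightarrow> bool" where
  "alm_execution \<mu>0 \<sigma> \<longleftrightarrow>
     (\<exists>s\<in>edom P. \<sigma> 0 = (0, Main 0 \<mu>0 0 s s)) \<and>
     (\<forall>i. if \<exists>c. alm_step (\<sigma> i) c then alm_step (\<sigma> i) (\<sigma> (Suc i)) else \<sigma> (Suc i) = \<sigma> i)"

end

definition complexity_T :: "real \<Rightarrow> real \<Rightarrow> real \<Rightarrow> real \<Rightarrow> real \<Rightarrow> real \<Rightarrow> real" where
  "complexity_T D_X D_bar B_bar C_bar L_dg t =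
     D_X * D_bar powr (3/2) * C_bar / t powr (7/4)
   + D_X * D_bar powr (5/4) * B_bar powr (1/2) * (1 + L_dg powr (1/2)) / t powr (11/8)
   + D_X * D_bar powr (1/4) * (L_dg + L_dg powr (1/2)) / t powr (9/8)
   + D_X * B_bar / t
   + D_bar powr (1/2) / t powr (1/2)"

text \<open>
  The constant hidden in the \<open>O\<close>-notation depends only on the parameters \<open>\<rho>\<^sub>0\<close> and \<open>\<eta>\<^sub>0\<close>, in
  particular not on the dimensions of the two spaces. Since the spaces are type variables, a
  constant bound by an existential quantifier inside the theorem could depend on them; a fixed
  function of the two parameters expresses the uniformity. Its value is not meant to be sharp.
\<close>

definition hidden_constant :: "real \<Rightarrow> real \<Rightarrow> real" where
  "hidden_constant \<rho>0 \<eta>0 = 10 ^ 9 * \<rho>0\<^sup>2 / \<eta>0"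

end

theory Submission
  imports Defs
begin

text \<open>
  The outer loop is an inexact proximal point method for the dual problem. If \<open>x\<^sup>*\<close> minimizes the
  augmented Lagrangian at \<open>\<mu>\<close>, then the updated multiplier \<open>\<mu>\<^sup>*\<close> is the proximal point of \<open>\<mu>\<close>, and
  every dual solution \<open>\<lambda>\<close> satisfies
  \<open>\<parallel>\<mu>\<^sup>* - \<mu>\<parallel>\<^sup>2 + \<parallel>\<mu>\<^sup>* - \<lambda>\<parallel>\<^sup>2 \<le> \<parallel>\<mu> - \<lambda>\<parallel>\<^sup>2\<close>
  (\<open>prox_point_fejer\<close>); an inner minimization up to \<open>\<eta>\<close> moves the updated multiplier by at most the
  square root of \<open>2 \<rho> \<eta>\<close> (\<open>multiplier_error\<close>). With the given parameters these errors add up, over \<open>k\<close>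
  outer iterations, to order \<open>k\<^bsup>1/2\<^esup> t\<^bsup>1/4\<^esup>\<close>, where \<open>t = min 1 \<epsilon>\<close>. An outer iteration that does not stop
  although \<open>\<eta>\<^sub>i / \<rho>\<^sub>i\<close> is small makes a proximal step of length at least \<open>(5/8) \<epsilon> \<rho>\<^sub>i\<close>, and the squares of
  these lengths have a sum of order \<open>\<epsilon>\<^sup>2 k\<^sup>4\<close>. Comparing both, the number of outer iterations is of order
  \<open>(max D\<^sub>\<Lambda> 1 / t)\<^bsup>1/2\<^esup>\<close> (\<open>outer_count\<close>), and the multipliers stay within a bounded distance of the dual
  solution, which bounds the Lipschitz constants \<open>L\<^sub>i\<close> of the inner problems.

  The inner method is an accelerated proximal gradient method: after \<open>j \<ge> 1\<close> iterations its
  suboptimality is at most \<open>2 L D\<^sub>X\<^sup>2 / (j + 1)\<^sup>2\<close> (\<open>accelerated_step\<close>), so it stops after at most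
  \<open>1 + D\<^sub>X (2 L\<^sub>i / \<eta>\<^sub>i)\<^bsup>1/2\<^esup>\<close> iterations (\<open>inner_inv_count\<close>). Summing over the outer iterations and adding
  the postprocessing run gives the complexity (\<open>total_count\<close>).

  An output of the main loop passes the \<open>\<epsilon>\<close>-KKT test by construction. For an output of the
  postprocessing subroutine, the proximal gradient step provides a subgradient with residual at most
  \<open>2 L \<parallel>x\<^sup>+ - x\<parallel>\<close>, and \<open>multiplier_error\<close> transfers the smallness of the multiplier displacement
  to the new point (\<open>postprocessing_eps_kkt\<close>). One point needs care: \<open>L\<^sub>g\<close> is a Lipschitz
  constant on the domain of \<open>P\<close>, which may have empty interior, so it bounds the Jacobian of \<open>g\<close> only
  along that domain. Gradient errors orthogonal to the domain are harmless because the
  subdifferential of \<open>P\<close> is invariant under adding vectors orthogonal to it.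
\<close>

section \<open>First-order conditions for convex functions\<close>

lemma right_derivative_le:
  fixes G :: "real \<Rightarrow> real"
  assumes "(G has_real_derivative d) (at 0)"
    and le: "\<And>s. 0 < s \<Longrightarrow> s < 1 \<Longrightarrow> G s \<le> G 0 + s * c"
  shows "d \<le> c"
proof -
  have "(G has_real_derivative d) (at_right 0)"
    using assms(1) by (rule has_field_derivative_at_within)
  then have lim: "((\<lambda>s. (G s - G 0) / (s - 0)) \<longlongrightarrow> d) (at_right 0)"
    by (simp add: has_field_derivative_iff)
  have "\<forall>\<^sub>F s in at_right (0::real). s \<in> {0<..<1}"
    by (rule eventually_at_right_real) simp
  then have "\<forall>\<^sub>F s in at_right (0::real). (G s - G 0) / (s - 0) \<le> c"
  proof eventually_elim
    case (elim s)
    then show ?case using le[of s] by (simp add: divide_le_eq mult.commute)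
  qed
  with lim show ?thesis
    by (rule tendsto_upperbound) simp
qed

lemma has_derivative_along_line:
  fixes q :: "'a::real_normed_vector \<Rightarrow> real"
  assumes "(q has_derivative D) (at (x + t *\<^sub>R d))"
  shows "((\<lambda>s. q (x + s *\<^sub>R d)) has_real_derivative D d) (at t)"
proof -
  have lin: "linear D"
    using assms has_derivative_linear by blast
  have "((\<lambda>s. x + s *\<^sub>R d) has_derivative (\<lambda>s. s *\<^sub>R d)) (at t)"
    by (auto intro!: derivative_eq_intros)
  then have "((\<lambda>s. q (x + s *\<^sub>R d)) has_derivative (\<lambda>s. D (s *\<^sub>R d))) (at t)"
    using assms by (rule has_derivative_compose[of "\<lambda>s. x + s *\<^sub>R d"])
  moreover have "(\<lambda>s. D (s *\<^sub>R d)) = (*) (D d)"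
    using lin by (auto simp: linear_cmul)
  ultimately show ?thesis
    by (simp add: has_field_derivative_def)
qed

lemma convex_on_segment_le:
  assumes "convex_on X q" "x \<in> X" "y \<in> X" "0 \<le> s" "s \<le> 1"
  shows "q (x + s *\<^sub>R (y - x)) \<le> q x + s * (q y - q x)"
proof -
  have "q ((1 - s) *\<^sub>R x + s *\<^sub>R y) \<le> (1 - s) * q x + s * q y"
    using assms by (intro convex_onD) auto
  then show ?thesis by (simp add: algebra_simps)
qed

lemma convex_segment_in:
  assumes "convex X" "x \<in> X" "y \<in> X" "0 \<le> s" "s \<le> 1"
  shows "x + s *\<^sub>R (y - x) \<in> X"
proof -
  have "(1 - s) *\<^sub>R x + s *\<^sub>R y \<in> X"
    using assms by (intro convexD) auto
  then show ?thesis by (simp add: algebra_simps)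
qed

lemma convex_on_above_tangent:
  fixes q :: "'a::real_normed_vector \<Rightarrow> real"
  assumes "convex_on X q" "x \<in> X" "y \<in> X" "(q has_derivative D) (at x)"
  shows "q x + D (y - x) \<le> q y"
proof -
  have "((\<lambda>s. q (x + s *\<^sub>R (y - x))) has_real_derivative D (y - x)) (at 0)"
    using assms by (intro has_derivative_along_line) simp
  then have "D (y - x) \<le> q y - q x"
    by (rule right_derivative_le) (use assms convex_on_segment_le in fastforce)
  then show ?thesis by simp
qed

text \<open>At a minimizer of a sum, the negative derivative of the smooth summand supports the convex
  summand from below, although the latter need not be differentiable.\<close>

lemma minimizer_subgradient:
  fixes p q :: "'a::real_normed_vector \<Rightarrow> real"
  assumes p: "convex_on X p" and z: "z \<in> X" and u: "u \<in> X"
    and min: "\<And>w. w \<in> X \<Longrightarrow> q z + p z \<le> q w + p w"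
    and D: "(q has_derivative D) (at z)"
  shows "p z - D (u - z) \<le> p u"
proof -
  have X: "convex X" using p by (simp add: convex_on_imp_convex)
  have "((\<lambda>s. q (z + s *\<^sub>R (u - z))) has_real_derivative D (u - z)) (at 0)"
    using D by (intro has_derivative_along_line) simp
  then have "((\<lambda>s. - q (z + s *\<^sub>R (u - z))) has_real_derivative - D (u - z)) (at 0)"
    by (rule DERIV_minus)
  then have "- D (u - z) \<le> p u - p z"
  proof (rule right_derivative_le)
    fix s :: real assume s: "0 < s" "s < 1"
    have "q z + p z \<le> q (z + s *\<^sub>R (u - z)) + p (z + s *\<^sub>R (u - z))"
      by (rule min) (use X z u s convex_segment_in in fastforce)
    also have "p (z + s *\<^sub>R (u - z)) \<le> p z + s * (p u - p z)"
      by (rule convex_on_segment_le[OF p z u]) (use s in auto)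
    finally show "- q (z + s *\<^sub>R (u - z)) \<le> - q (z + 0 *\<^sub>R (u - z)) + s * (p u - p z)"
      by simp
  qed
  then show ?thesis by simp
qed

text \<open>The minimization step shared by the inner method and the proximal step.\<close>

lemma proximal_minimizer_subgradient:
  fixes p :: "'a::euclidean_space \<Rightarrow> real"
  assumes p: "convex_on X p" and z: "z' \<in> X" and u: "u \<in> X"
    and min: "\<And>w. w \<in> X \<Longrightarrow> a \<bullet> z' + c * (norm (z' - z))\<^sup>2 + p z' \<le> a \<bullet> w + c * (norm (w - z))\<^sup>2 + p w"
  shows "p z' + ((2 * c) *\<^sub>R (z - z') - a) \<bullet> (u - z') \<le> p u"
proof -
  let ?q = "\<lambda>w. a \<bullet> w + c * ((w - z) \<bullet> (w - z))"
  let ?D = "\<lambda>h. a \<bullet> h + c * (2 * (h \<bullet> (z' - z)))"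
  have "(?q has_derivative ?D) (at z')"
    by (auto intro!: derivative_eq_intros simp: inner_commute algebra_simps)
  then have "p z' - ?D (u - z') \<le> p u"
    by (rule minimizer_subgradient[OF p z u, rotated])
       (use min in \<open>simp add: power2_norm_eq_inner\<close>)
  then show ?thesis
    by (simp add: algebra_simps inner_commute)
qed

text \<open>Only the component of the gradient along the segment enters, so the set may have empty interior
  and the gradient may vary arbitrarily in directions transversal to it.\<close>

lemma descent_bound:
  fixes q :: "'a::real_inner \<Rightarrow> real"
  assumes X: "convex X" "x \<in> X" "y \<in> X"
    and D: "\<And>w. w \<in> X \<Longrightarrow> (q has_derivative (\<lambda>h. h \<bullet> G w)) (at w)"
    and lip: "\<And>v w. v \<in> X \<Longrightarrow> w \<in> X \<Longrightarrow> (y - x) \<bullet> (G w - G v) \<le> L * norm (w - v) * norm (y - x)"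
  shows "q y \<le> q x + G x \<bullet> (y - x) + L / 2 * (norm (y - x))\<^sup>2"
proof -
  let ?d = "y - x"
  let ?h = "\<lambda>s::real. q (x + s *\<^sub>R ?d) - s * (?d \<bullet> G x) - L / 2 * s\<^sup>2 * (norm ?d)\<^sup>2"
  have "?h 1 \<le> ?h 0"
  proof (rule DERIV_nonpos_imp_nonincreasing[of 0 1 ?h])
    fix s :: real assume s: "0 \<le> s" "s \<le> 1"
    have in_X: "x + s *\<^sub>R ?d \<in> X" using X s by (intro convex_segment_in)
    have "((\<lambda>s. q (x + s *\<^sub>R ?d)) has_real_derivative ?d \<bullet> G (x + s *\<^sub>R ?d)) (at s)"
      by (rule has_derivative_along_line[OF D[OF in_X]])
    then have "(?h has_real_derivative
        ?d \<bullet> G (x + s *\<^sub>R ?d) - ?d \<bullet> G x - L / 2 * (2 * s) * (norm ?d)\<^sup>2) (at s)"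
      by (auto intro!: derivative_eq_intros)
    moreover have "?d \<bullet> (G (x + s *\<^sub>R ?d) - G x) \<le> L * norm (x + s *\<^sub>R ?d - x) * norm ?d"
      by (rule lip[OF X(2) in_X])
    then have "?d \<bullet> G (x + s *\<^sub>R ?d) - ?d \<bullet> G x - L / 2 * (2 * s) * (norm ?d)\<^sup>2 \<le> 0"
      using s by (simp add: inner_diff_right power2_eq_square mult_ac)
    ultimately show "\<exists>y. (?h has_real_derivative y) (at s) \<and> y \<le> 0" by blast
  qed simp
  then show ?thesis by (simp add: inner_commute)
qed

section \<open>Extended-valued functions with compact domain\<close>

lemma proper_closed_convex_finite:
  assumes "proper_closed_convex h" "x \<in> edom h"
  shows "h x = ereal (real_of_ereal (h x))"
proof -
  have "h x \<noteq> -\<infinity>" "h x \<noteq> \<infinity>"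
    using assms by (auto simp: proper_closed_convex_def edom_def)
  then show ?thesis by (cases "h x") auto
qed

lemma proper_closed_convex_not_edom: "x \<notin> edom h \<Longrightarrow> h x = \<infinity>"
  by (simp add: edom_def)

lemma edom_nonempty: "proper_closed_convex h \<Longrightarrow> edom h \<noteq> {}"
  by (auto simp: proper_closed_convex_def edom_def)

lemma convex_on_real_of_ereal:
  assumes h: "proper_closed_convex h" and X: "convex X" "X \<subseteq> edom h"
  shows "convex_on X (\<lambda>x. real_of_ereal (h x))"
proof (rule convex_onI)
  fix t :: real and x y assume t: "0 < t" "t < 1" and xy: "x \<in> X" "y \<in> X"
  let ?r = "\<lambda>x. real_of_ereal (h x)"
  have "(x, ?r x) \<in> ereal_epigraph h" "(y, ?r y) \<in> ereal_epigraph h"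
    using proper_closed_convex_finite[OF h] xy X by (auto simp: ereal_epigraph_def)
  then have "(1 - t) *\<^sub>R (x, ?r x) + t *\<^sub>R (y, ?r y) \<in> ereal_epigraph h"
    using h t by (intro convexD) (auto simp: proper_closed_convex_def)
  then have le: "h ((1 - t) *\<^sub>R x + t *\<^sub>R y) \<le> ereal ((1 - t) * ?r x + t * ?r y)"
    by (simp add: ereal_epigraph_def)
  have "(1 - t) *\<^sub>R x + t *\<^sub>R y \<in> edom h"
    using X xy t by (intro subsetD[OF X(2)] convexD) auto
  from proper_closed_convex_finite[OF h this] le
  show "?r ((1 - t) *\<^sub>R x + t *\<^sub>R y) \<le> (1 - t) * ?r x + t * ?r y"
    by (metis ereal_less_eq(3))
qed (use X in simp)

lemma convex_edom:
  assumes h: "proper_closed_convex h"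
  shows "convex (edom h)"
proof (rule convexI)
  fix x y and u v :: real assume xy: "x \<in> edom h" "y \<in> edom h" and uv: "0 \<le> u" "0 \<le> v" "u + v = 1"
  let ?r = "\<lambda>x. real_of_ereal (h x)"
  have "(x, ?r x) \<in> ereal_epigraph h" "(y, ?r y) \<in> ereal_epigraph h"
    using proper_closed_convex_finite[OF h] xy by (auto simp: ereal_epigraph_def)
  then have "u *\<^sub>R (x, ?r x) + v *\<^sub>R (y, ?r y) \<in> ereal_epigraph h"
    using h uv by (intro convexD) (auto simp: proper_closed_convex_def)
  then have "h (u *\<^sub>R x + v *\<^sub>R y) \<le> ereal (u * ?r x + v * ?r y)"
    by (simp add: ereal_epigraph_def)
  then show "u *\<^sub>R x + v *\<^sub>R y \<in> edom h"
    by (auto simp: edom_def elim: le_less_trans)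
qed

text \<open>A closed epigraph means lower semicontinuity, so sublevel sets of the sum with a continuous
  function are closed; those at the values of the function have the finite intersection
  property.\<close>

lemma closed_epigraph_attains_min:
  fixes h :: "'a::euclidean_space \<Rightarrow> ereal"
  assumes h: "proper_closed_convex h" and X: "compact (edom h)" and q: "continuous_on (edom h) q"
  shows "\<exists>z\<in>edom h. \<forall>w\<in>edom h. q z + real_of_ereal (h z) \<le> q w + real_of_ereal (h w)"
proof -
  let ?X = "edom h"
  let ?F = "\<lambda>x. q x + real_of_ereal (h x)"
  let ?A = "\<lambda>w. {x \<in> ?X. ?F x \<le> ?F w}"
  have A: "?A w = {x \<in> ?X. (x, ?F w - q x) \<in> ereal_epigraph h}" for w
    using proper_closed_convex_finite[OF h] by (auto simp: ereal_epigraph_def) (metis add.commute le_diff_eq ereal_less_eq(3))+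
  have "?X \<inter> (\<Inter>w\<in>?X. ?A w) \<noteq> {}"
  proof (rule compact_imp_fip_image[OF X])
    fix w assume "w \<in> ?X"
    have "closed (ereal_epigraph h)" using h by (simp add: proper_closed_convex_def)
    moreover have "continuous_on ?X (\<lambda>x. (x, ?F w - q x))"
      by (intro continuous_intros q)
    ultimately have "closed ((\<lambda>x. (x, ?F w - q x)) -` ereal_epigraph h \<inter> ?X)"
      using compact_imp_closed[OF X] continuous_on_closed_vimage by blast
    moreover have "(\<lambda>x. (x, ?F w - q x)) -` ereal_epigraph h \<inter> ?X = ?A w"
      unfolding A by blast
    ultimately show "closed (?A w)" by metis
  next
    fix I assume I: "finite I" "I \<subseteq> ?X"
    show "?X \<inter> (\<Inter>w\<in>I. ?A w) \<noteq> {}"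
    proof (cases "I = {}")
      case True
      then show ?thesis using edom_nonempty[OF h] by simp
    next
      case False
      define m where "m = arg_min_on ?F I"
      have "m \<in> I" unfolding m_def using I(1) False by (rule arg_min_if_finite(1))
      moreover have "?F m \<le> ?F w" if "w \<in> I" for w
        unfolding m_def using I(1) False that by (rule arg_min_least)
      ultimately have "m \<in> ?X \<inter> (\<Inter>w\<in>I. ?A w)" using I(2) by auto
      then show ?thesis by (metis empty_iff)
    qed
  qed
  then obtain z where "z \<in> ?X" "\<And>w. w \<in> ?X \<Longrightarrow> z \<in> ?A w" by auto
  then show ?thesis by (intro bexI[of _ z]) auto
qed

lemma grad_eqI:
  assumes "GDERIV (\<lambda>y. real_of_ereal (h y)) x :> D"
  shows "grad h x = D"
  unfolding grad_def
proof (rule the_equality, rule assms)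
  fix E assume "GDERIV (\<lambda>y. real_of_ereal (h y)) x :> E"
  then have "(\<lambda>v. v \<bullet> E) = (\<lambda>v. v \<bullet> D)"
    using assms unfolding gderiv_def by (rule has_derivative_unique)
  then show "E = D" by (simp add: fun_eq_iff vector_eq_ldot)
qed

lemma is_arg_min_ereal_iff:
  assumes h: "proper_closed_convex h" and c: "0 < c"
    and F: "\<And>w. F w = ereal (q w) + ereal c * h w"
  shows "is_arg_min F (\<lambda>_. True) z \<longleftrightarrow>
    z \<in> edom h \<and> (\<forall>w\<in>edom h. q z + c * real_of_ereal (h z) \<le> q w + c * real_of_ereal (h w))"
proof -
  have fin: "F w = ereal (q w + c * real_of_ereal (h w))" if "w \<in> edom h" for w
    unfolding F by (subst proper_closed_convex_finite[OF h that]) simp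
  have inf: "F w = \<infinity>" if "w \<notin> edom h" for w
    unfolding F using that c by (simp add: proper_closed_convex_not_edom)
  obtain w0 where w0: "w0 \<in> edom h" using edom_nonempty[OF h] by blast
  show ?thesis
  proof
    assume L: "is_arg_min F (\<lambda>_. True) z"
    then have le: "F z \<le> F w" for w by (simp add: is_arg_min_def not_less)
    have "z \<in> edom h"
    proof (rule ccontr)
      assume "z \<notin> edom h"
      then show False using le[of w0] inf[of z] fin[OF w0] by simp
    qed
    moreover have "q z + c * real_of_ereal (h z) \<le> q w + c * real_of_ereal (h w)" if "w \<in> edom h" for w
      using le[of w] fin[OF that] fin[OF \<open>z \<in> edom h\<close>] by simp
    ultimately show "z \<in> edom h \<and> (\<forall>w\<in>edom h. q z + c * real_of_ereal (h z) \<le> q w + c * real_of_ereal (h w))"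
      by blast
  next
    assume R: "z \<in> edom h \<and> (\<forall>w\<in>edom h. q z + c * real_of_ereal (h z) \<le> q w + c * real_of_ereal (h w))"
    have "F z \<le> F w" for w
    proof (cases "w \<in> edom h")
      case True
      then show ?thesis using R fin by simp
    next
      case False
      then show ?thesis using inf by simp
    qed
    then show "is_arg_min F (\<lambda>_. True) z" by (simp add: is_arg_min_def not_less)
  qed
qed

section \<open>Projection onto the dual cone\<close>

lemma dual_cone_properties:
  fixes K :: "'b::euclidean_space set"
  shows "closed (dual_cone K)" "convex (dual_cone K)" "0 \<in> dual_cone K"
    "\<And>c y. y \<in> dual_cone K \<Longrightarrow> 0 \<le> c \<Longrightarrow> c *\<^sub>R y \<in> dual_cone K"
proof -
  have "dual_cone K = (\<Inter>x\<in>K. {y. x \<bullet> y \<ge> 0})"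
    by (auto simp: dual_cone_def inner_commute)
  then show "closed (dual_cone K)" "convex (dual_cone K)"
    by (auto intro!: closed_INT closed_halfspace_ge convex_INT convex_halfspace_ge)
qed (auto simp: dual_cone_def)

lemma closest_point_dual_cone:
  fixes K :: "'b::euclidean_space set" and u :: 'b
  defines "p \<equiv> closest_point (dual_cone K) u"
  shows "p \<in> dual_cone K" "p \<bullet> u = p \<bullet> p" "\<And>y. y \<in> dual_cone K \<Longrightarrow> y \<bullet> u \<le> y \<bullet> p"
proof -
  note dc = dual_cone_properties[where K=K]
  show p: "p \<in> dual_cone K"
    unfolding p_def using dc by (intro closest_point_in_set) auto
  have dot: "(u - p) \<bullet> (y - p) \<le> 0" if "y \<in> dual_cone K" for y
    unfolding p_def using dc that by (intro closest_point_dot) auto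
  have "(u - p) \<bullet> (2 *\<^sub>R p - p) \<le> 0" "(u - p) \<bullet> (0 - p) \<le> 0"
    using dc p by (intro dot; simp)+
  then show eq: "p \<bullet> u = p \<bullet> p"
    by (simp add: inner_commute algebra_simps scaleR_2)
  show "y \<bullet> u \<le> y \<bullet> p" if "y \<in> dual_cone K" for y
    using dot[OF that] eq by (simp add: inner_commute algebra_simps)
qed

text \<open>Moreau's decomposition: the residual of the projection onto \<open>-K\<close> is the projection onto the
  dual cone. Starting from the former avoids the bipolar theorem.\<close>

lemma infdist_neg_cone:
  fixes K :: "'b::euclidean_space set"
  assumes K: "closed K" "convex_cone K"
  shows "infdist u (uminus ` K) = norm (closest_point (dual_cone K) u)"
proof -
  let ?N = "uminus ` K"
  define q where "q = closest_point ?N u"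
  have N: "closed ?N" "convex ?N" "?N \<noteq> {}"
    using K by (auto simp: closed_negations convex_negations convex_cone_def)
  have qN: "q \<in> ?N" unfolding q_def using N by (intro closest_point_in_set)
  have cone: "c *\<^sub>R y \<in> ?N" if "y \<in> ?N" "0 \<le> c" for c y
    using that K(2) unfolding convex_cone_def conic_def by (force simp: image_iff)
  have add: "y + z \<in> ?N" if "y \<in> ?N" "z \<in> ?N" for y z
  proof -
    have "(1/2) *\<^sub>R y + (1/2) *\<^sub>R z \<in> ?N" using N that by (intro convexD) auto
    then have "2 *\<^sub>R ((1/2) *\<^sub>R y + (1/2) *\<^sub>R z) \<in> ?N" by (rule cone) simp
    then show ?thesis by (simp add: algebra_simps)
  qed
  have dot: "(u - q) \<bullet> (y - q) \<le> 0" if "y \<in> ?N" for y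
    unfolding q_def using N that by (intro closest_point_dot) auto
  have "(u - q) \<bullet> (2 *\<^sub>R q - q) \<le> 0" "(u - q) \<bullet> (0 *\<^sub>R q - q) \<le> 0"
    by (intro dot cone qN; simp)+
  then have orth: "(u - q) \<bullet> q = 0" by (simp add: algebra_simps scaleR_2)
  have uq: "u - q \<in> dual_cone K"
    unfolding dual_cone_def
  proof safe
    fix y assume "y \<in> K"
    then have "- y + q \<in> ?N" using qN by (intro add) auto
    from dot[OF this] show "0 \<le> (u - q) \<bullet> y" by simp
  qed
  have "u - q = closest_point (dual_cone K) u"
  proof (rule closest_point_unique)
    show "\<forall>z\<in>dual_cone K. dist u (u - q) \<le> dist u z"
    proof
      fix z assume z: "z \<in> dual_cone K"
      from qN obtain k where k: "k \<in> K" "q = - k" by auto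
      have "0 \<le> z \<bullet> k" using z k by (auto simp: dual_cone_def)
      then have "z \<bullet> q \<le> 0" using k by simp
      then have "q \<bullet> q \<le> q \<bullet> (u - z)" using orth
        by (simp add: inner_commute inner_diff_left inner_diff_right)
      also have "\<dots> \<le> norm q * norm (u - z)" by (rule norm_cauchy_schwarz)
      finally have "norm q * norm q \<le> norm q * norm (u - z)"
        by (simp flip: power2_norm_eq_inner power2_eq_square)
      then show "dist u (u - q) \<le> dist u z"
        by (cases "q = 0") (auto simp: dist_norm)
    qed
  qed (use dual_cone_properties[where K=K] uq in auto)
  moreover have "infdist u ?N = dist u q"
    using N by (simp add: q_def infdist_eq_setdist setdist_closest_point)
  ultimately show ?thesis by (simp add: dist_norm)
qed

text \<open>Half the squared distance to \<open>-K\<close> is the conjugate of half the squared norm on the dual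
  cone, hence the supremum of \<open>\<mu> \<bullet> u - \<parallel>\<mu>\<parallel>\<^sup>2 / 2\<close> over the dual cone, with a quadratic gap.\<close>

lemma conjugate_gap:
  fixes K :: "'b::euclidean_space set" and u :: 'b
  defines "p \<equiv> closest_point (dual_cone K) u"
  assumes "y \<in> dual_cone K"
  shows "2 * (y \<bullet> u) - (norm y)\<^sup>2 + (norm (p - y))\<^sup>2 \<le> (norm p)\<^sup>2"
  using closest_point_dual_cone(3)[OF assms(2), of u, folded p_def]
  by (simp add: power2_norm_eq_inner inner_commute algebra_simps)

text \<open>The squared norm of the projection is convex with twice the projection as gradient: the first
  inequality is the conjugate gap at the projection of \<open>u\<close>, and the second one follows by exchanging
  \<open>u\<close> and \<open>v\<close> and using that the projection is nonexpansive.\<close>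

lemma norm_proj_dual_cone_convex_smooth:
  fixes K :: "'b::euclidean_space set" and u v :: 'b
  defines "p \<equiv> closest_point (dual_cone K)"
  shows "(norm (p u))\<^sup>2 + 2 * (p u \<bullet> (v - u)) + (norm (p v - p u))\<^sup>2 \<le> (norm (p v))\<^sup>2"
    and "(norm (p v))\<^sup>2 \<le> (norm (p u))\<^sup>2 + 2 * (p u \<bullet> (v - u)) + 2 * (norm (v - u))\<^sup>2"
    and "norm (p v - p u) \<le> norm (v - u)"
    and "norm (p v) \<le> norm v"
proof -
  have low: "(norm (p u))\<^sup>2 + 2 * (p u \<bullet> (v - u)) + (norm (p v - p u))\<^sup>2 \<le> (norm (p v))\<^sup>2" for u v
    using conjugate_gap[OF closest_point_dual_cone(1)[of K u], of v, folded p_def]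
      closest_point_dual_cone(2)[of K u, folded p_def]
    by (simp add: power2_norm_eq_inner algebra_simps)
  show "(norm (p u))\<^sup>2 + 2 * (p u \<bullet> (v - u)) + (norm (p v - p u))\<^sup>2 \<le> (norm (p v))\<^sup>2"
    by (rule low)
  show ne: "norm (p v - p u) \<le> norm (v - u)" for u v
    using closest_point_lipschitz[of "dual_cone K" v u] dual_cone_properties[where K=K]
    unfolding p_def dist_norm by blast
  have p0: "p 0 = 0" unfolding p_def using dual_cone_properties[where K=K] by (intro closest_point_self)
  show "norm (p v) \<le> norm v" using ne[of v 0] p0 by simp
  have "(norm (p v))\<^sup>2 \<le> (norm (p u))\<^sup>2 + 2 * (p v \<bullet> (v - u))"
  proof -
    have "p v \<bullet> (v - u) = - (p v \<bullet> (u - v))" by (simp add: inner_diff_right)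
    then show ?thesis
      using low[of v u] zero_le_power2[of "norm (p u - p v)"] by linarith
  qed
  also have "p v \<bullet> (v - u) = p u \<bullet> (v - u) + (p v - p u) \<bullet> (v - u)"
    by (simp add: algebra_simps)
  also have "(p v - p u) \<bullet> (v - u) \<le> norm (v - u) * norm (v - u)"
    using norm_cauchy_schwarz[of "p v - p u" "v - u"] mult_right_mono[OF ne[of v u], of "norm (v - u)"]
    by simp
  finally show "(norm (p v))\<^sup>2 \<le> (norm (p u))\<^sup>2 + 2 * (p u \<bullet> (v - u)) + 2 * (norm (v - u))\<^sup>2"
    by (simp add: power2_eq_square algebra_simps)
qed

lemma has_derivative_half_sq_proj_dual_cone:
  fixes K :: "'b::euclidean_space set" and u :: 'b
  defines "p \<equiv> closest_point (dual_cone K)"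
  shows "((\<lambda>u. (norm (p u))\<^sup>2 / 2) has_derivative (\<lambda>h. p u \<bullet> h)) (at u)"
  unfolding has_derivative_at
proof (intro conjI)
  show "bounded_linear ((\<bullet>) (p u))" by (rule bounded_linear_inner_right)
  have bound: "norm (norm ((norm (p (u + h)))\<^sup>2 / 2 - (norm (p u))\<^sup>2 / 2 - p u \<bullet> h) / norm h) \<le> norm h" for h
  proof -
    let ?r = "(norm (p (u + h)))\<^sup>2 / 2 - (norm (p u))\<^sup>2 / 2 - p u \<bullet> h"
    have "(norm (p u))\<^sup>2 + 2 * (p u \<bullet> h) + (norm (p (u + h) - p u))\<^sup>2 \<le> (norm (p (u + h)))\<^sup>2"
      using norm_proj_dual_cone_convex_smooth(1)[of K u "u + h", folded p_def] by simp
    then have "0 \<le> ?r"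
      using zero_le_power2[of "norm (p (u + h) - p u)"] by linarith
    moreover have "?r \<le> norm h * norm h"
      using norm_proj_dual_cone_convex_smooth(2)[of K "u + h" u, folded p_def]
      by (simp add: power2_eq_square)
    ultimately show ?thesis by (cases "h = 0") (simp_all add: divide_le_eq)
  qed
  show "(\<lambda>h. norm ((norm (p (u + h)))\<^sup>2 / 2 - (norm (p u))\<^sup>2 / 2 - p u \<bullet> h) / norm h) \<midarrow>0\<rightarrow> 0"
  proof (rule Lim_null_comparison[where g = norm])
    show "norm \<midarrow>0\<rightarrow> (0::real)"
      by (rule tendsto_norm_zero) (rule tendsto_ident_at)
  qed (use bound in simp)
qed

section \<open>The accelerated inner method\<close>

text \<open>The potential \<open>(j + 1)\<^sup>2 (F x - F u) + 2 L \<parallel>z - u\<parallel>\<^sup>2\<close> does not increase, because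
  \<open>j (j + 2) \<le> (j + 1)\<^sup>2\<close> and \<open>u\<close> is a minimizer. At \<open>j = 0\<close> the first term of the bound
  vanishes, so that the initial value of the objective is irrelevant.\<close>

lemma accelerated_step:
  fixes \<phi> p :: "'a::euclidean_space \<Rightarrow> real"
  assumes p: "convex_on X p" and X: "x \<in> X" "z \<in> X" "z' \<in> X" "u \<in> X" and L: "0 \<le> L"
    and lower: "\<And>v w. v \<in> X \<Longrightarrow> w \<in> X \<Longrightarrow> \<phi> v + G v \<bullet> (w - v) \<le> \<phi> w"
    and upper: "\<And>v w. v \<in> X \<Longrightarrow> w \<in> X \<Longrightarrow> \<phi> w \<le> \<phi> v + G v \<bullet> (w - v) + L / 2 * (norm (w - v))\<^sup>2"
    and y: "y = (1 / (real j + 2)) *\<^sub>R (real j *\<^sub>R x + 2 *\<^sub>R z)"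
    and x': "x' = (1 / (real j + 2)) *\<^sub>R (real j *\<^sub>R x + 2 *\<^sub>R z')"
    and min: "\<And>w. w \<in> X \<Longrightarrow> G y \<bullet> z' + L / (real j + 2) * (norm (z' - z))\<^sup>2 + p z'
        \<le> G y \<bullet> w + L / (real j + 2) * (norm (w - z))\<^sup>2 + p w"
  shows "y \<in> X" "x' \<in> X"
    "(real j + 2)\<^sup>2 * (\<phi> x' + p x' - (\<phi> u + p u)) + 2 * L * (norm (z' - u))\<^sup>2
      \<le> real j * (real j + 2) * (\<phi> x + p x - (\<phi> u + p u)) + 2 * L * (norm (z - u))\<^sup>2"
proof -
  define t where "t = 2 / (real j + 2)"
  have t: "0 < t" "t \<le> 1" by (auto simp: t_def divide_le_eq)
  have t1: "1 - t = real j / (real j + 2)" by (simp add: t_def field_simps)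
  have cX: "convex X" using p by (rule convex_on_imp_convex)
  have y': "y = (1 - t) *\<^sub>R x + t *\<^sub>R z" and x'': "x' = (1 - t) *\<^sub>R x + t *\<^sub>R z'"
    unfolding y x' t1 by (simp_all add: t_def scaleR_add_right)
  show yX: "y \<in> X" and x'X: "x' \<in> X"
    unfolding y' x'' using cX X t by (auto intro!: convexD)
  define c where "c = L / (real j + 2)"
  have Lt: "L * t = 2 * c" by (simp add: c_def t_def)
  have sub: "p z' + ((2 * c) *\<^sub>R (z - z') - G y) \<bullet> (u - z') \<le> p u"
    by (rule proximal_minimizer_subgradient[OF p X(3,4)]) (use min in \<open>simp add: c_def\<close>)
  have "2 * ((z - z') \<bullet> (u - z')) = (norm (z' - z))\<^sup>2 + (norm (z' - u))\<^sup>2 - (norm (z - u))\<^sup>2"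
    by (simp add: power2_norm_eq_inner inner_commute algebra_simps)
  then have "((2 * c) *\<^sub>R (z - z')) \<bullet> (u - z') = c * ((norm (z' - z))\<^sup>2 + (norm (z' - u))\<^sup>2 - (norm (z - u))\<^sup>2)"
    by (metis (no_types, opaque_lifting) inner_scaleR_left mult.assoc mult.commute)
  then have three: "G y \<bullet> (z' - y) + p z' + c * (norm (z' - z))\<^sup>2
      \<le> G y \<bullet> (u - y) + p u + c * ((norm (z - u))\<^sup>2 - (norm (z' - u))\<^sup>2)"
    using sub by (simp add: inner_diff_left inner_diff_right algebra_simps)
  have x'y: "x' - y = t *\<^sub>R (z' - z)" unfolding y' x'' by (simp add: algebra_simps)
  have x'y': "x' - y = (1 - t) *\<^sub>R (x - y) + t *\<^sub>R (z' - y)" unfolding x'' by (simp add: algebra_simps)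
  have "\<phi> x' \<le> \<phi> y + G y \<bullet> (x' - y) + L / 2 * (norm (x' - y))\<^sup>2"
    by (rule upper[OF yX x'X])
  also have "L / 2 * (norm (x' - y))\<^sup>2 = t * (c * (norm (z' - z))\<^sup>2)"
  proof -
    have "L / 2 * (norm (x' - y))\<^sup>2 = t * (L * t) / 2 * (norm (z' - z))\<^sup>2"
      unfolding x'y by (simp add: power_mult_distrib power2_eq_square)
    then show ?thesis unfolding Lt by simp
  qed
  also have "G y \<bullet> (x' - y) = (1 - t) * (G y \<bullet> (x - y)) + t * (G y \<bullet> (z' - y))"
    unfolding x'y' by (simp add: inner_add_right)
  finally have a: "\<phi> x' \<le> (1 - t) * (\<phi> y + G y \<bullet> (x - y)) + t * (\<phi> y + G y \<bullet> (z' - y) + c * (norm (z' - z))\<^sup>2)"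
    by (simp add: algebra_simps)
  have b: "p x' \<le> (1 - t) * p x + t * p z'"
    unfolding x'' using p t X by (intro convex_onD) auto
  have "\<phi> x' + p x' \<le> (1 - t) * (\<phi> y + G y \<bullet> (x - y) + p x)
      + t * (\<phi> y + (G y \<bullet> (z' - y) + p z' + c * (norm (z' - z))\<^sup>2))"
    using a b by (simp add: algebra_simps)
  also have "\<dots> \<le> (1 - t) * (\<phi> x + p x)
      + t * (\<phi> y + (G y \<bullet> (u - y) + p u + c * ((norm (z - u))\<^sup>2 - (norm (z' - u))\<^sup>2)))"
  proof (rule add_mono)
    show "(1 - t) * (\<phi> y + G y \<bullet> (x - y) + p x) \<le> (1 - t) * (\<phi> x + p x)"
      using lower[OF yX X(1)] t by (intro mult_left_mono) auto
    show "t * (\<phi> y + (G y \<bullet> (z' - y) + p z' + c * (norm (z' - z))\<^sup>2))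
        \<le> t * (\<phi> y + (G y \<bullet> (u - y) + p u + c * ((norm (z - u))\<^sup>2 - (norm (z' - u))\<^sup>2)))"
      using three t by (intro mult_left_mono) auto
  qed
  also have "\<dots> \<le> (1 - t) * (\<phi> x + p x)
      + t * (\<phi> u + p u + c * ((norm (z - u))\<^sup>2 - (norm (z' - u))\<^sup>2))"
    using lower[OF yX X(4)] t by (intro add_left_mono mult_left_mono) auto
  finally have main: "\<phi> x' + p x' - (\<phi> u + p u) \<le> (1 - t) * (\<phi> x + p x - (\<phi> u + p u))
      + t * c * ((norm (z - u))\<^sup>2 - (norm (z' - u))\<^sup>2)"
    by (simp add: algebra_simps)
  have j2: "(real j + 2)\<^sup>2 * (t * c) = 2 * L" "(real j + 2)\<^sup>2 * (1 - t) = real j * (real j + 2)"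
    unfolding t1 by (simp_all add: t_def c_def power2_eq_square)
  have "(real j + 2)\<^sup>2 * (\<phi> x' + p x' - (\<phi> u + p u))
      \<le> (real j + 2)\<^sup>2 * ((1 - t) * (\<phi> x + p x - (\<phi> u + p u))
      + t * c * ((norm (z - u))\<^sup>2 - (norm (z' - u))\<^sup>2))"
    using main by (rule mult_left_mono) simp
  also have "\<dots> = ((real j + 2)\<^sup>2 * (1 - t)) * (\<phi> x + p x - (\<phi> u + p u))
      + ((real j + 2)\<^sup>2 * (t * c)) * ((norm (z - u))\<^sup>2 - (norm (z' - u))\<^sup>2)"
    by (simp only: distrib_left mult.assoc)
  finally show "(real j + 2)\<^sup>2 * (\<phi> x' + p x' - (\<phi> u + p u)) + 2 * L * (norm (z' - u))\<^sup>2
      \<le> real j * (real j + 2) * (\<phi> x + p x - (\<phi> u + p u)) + 2 * L * (norm (z - u))\<^sup>2"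
    unfolding j2 right_diff_distrib[of "2 * L"] by linarith
qed

section \<open>The smooth conic program\<close>

locale smooth_conic_program =
  fixes f P :: "'a::euclidean_space \<Rightarrow> ereal"
    and g :: "'a \<Rightarrow> 'b::euclidean_space"
    and K :: "'b set"
    and \<Omega> :: "'a set"
    and L_f L_dg L_g M_g D_X :: real
  assumes f: "proper_closed_convex f"
    and P: "proper_closed_convex P"
    and K: "closed K" "convex_cone K"
    and g: "cone_convex K g"
    and dom_P: "compact (edom P)"
    and \<Omega>: "open \<Omega>" "edom P \<subseteq> \<Omega>"
    and f_smooth: "cont_diff_fun_on \<Omega> f" "L_f-lipschitz_on \<Omega> (grad f)"
    and g_smooth: "cont_diff_map_on \<Omega> g" "grad_map_lipschitz_on L_dg \<Omega> g"
    and L_g: "L_g-lipschitz_on (edom P) g"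
    and M_g: "M_g = (SUP x\<in>edom P. norm (g x))"
    and D_X: "D_X = diameter (edom P)"
begin

abbreviation "X \<equiv> edom P"
abbreviation "fr x \<equiv> real_of_ereal (f x)"
abbreviation "Pr x \<equiv> real_of_ereal (P x)"
abbreviation "proj \<equiv> closest_point (dual_cone K)"
abbreviation "jac x \<equiv> frechet_derivative g (at x)"
abbreviation "lip \<equiv> smooth_lip L_f L_dg L_g M_g"

text \<open>The squared distance to \<open>-K\<close> is written as the squared norm of the projection onto the dual
  cone, whose gradient is twice that projection.\<close>

definition smooth :: "'b \<Rightarrow> real \<Rightarrow> 'a \<Rightarrow> real" where
  "smooth \<mu> r x = fr x + (norm (proj (\<mu> + r *\<^sub>R g x)))\<^sup>2 / (2 * r)"

definition smooth_grad :: "'b \<Rightarrow> real \<Rightarrow> 'a \<Rightarrow> 'a" where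
  "smooth_grad \<mu> r x = grad f x + grad_map g x (proj (\<mu> + r *\<^sub>R g x))"

text \<open>The constant \<open>\<parallel>\<mu>\<parallel>\<^sup>2 / (2 r)\<close> of the augmented Lagrangian is dropped.\<close>

definition auglag :: "'b \<Rightarrow> real \<Rightarrow> 'a \<Rightarrow> real" where
  "auglag \<mu> r x = smooth \<mu> r x + Pr x"

definition auglag_min :: "'b \<Rightarrow> real \<Rightarrow> 'a" where
  "auglag_min \<mu> r = (SOME x. x \<in> X \<and> (\<forall>y\<in>X. auglag \<mu> r x \<le> auglag \<mu> r y))"

lemma f_finite: "x \<in> \<Omega> \<Longrightarrow> f x = ereal (fr x)"
  using f_smooth(1) by (cases "f x") (auto simp: cont_diff_fun_on_def)

lemma P_finite: "x \<in> X \<Longrightarrow> P x = ereal (Pr x)"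
  by (rule proper_closed_convex_finite[OF P])

lemma P_infinite: "x \<notin> X \<Longrightarrow> P x = \<infinity>"
  by (rule proper_closed_convex_not_edom)

lemma f_not_MInf: "f x \<noteq> -\<infinity>"
  using f by (simp add: proper_closed_convex_def)

lemma X_convex: "convex X" by (rule convex_edom[OF P])

lemma X_nonempty: "X \<noteq> {}" by (rule edom_nonempty[OF P])

lemma Pr_convex: "convex_on X Pr"
  by (rule convex_on_real_of_ereal[OF P X_convex order_refl])

lemma fr_convex: "convex_on X fr"
proof (rule convex_on_real_of_ereal[OF f X_convex])
  show "X \<subseteq> edom f"
    using f_finite \<Omega>(2) by (fastforce simp: edom_def)
qed

lemma inner_g_convex: assumes "y \<in> dual_cone K" shows "convex_on X (\<lambda>x. y \<bullet> g x)"
proof (rule convex_onI)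
  fix t :: real and u v assume t: "0 < t" "t < 1"
  have "cone_le K (g ((1 - t) *\<^sub>R u + (1 - (1 - t)) *\<^sub>R v)) ((1 - t) *\<^sub>R g u + (1 - (1 - t)) *\<^sub>R g v)"
    using g t unfolding cone_convex_def by (meson atLeastAtMost_iff diff_ge_0_iff_ge diff_le_eq le_add_same_cancel1 less_imp_le)
  then have "0 \<le> y \<bullet> ((1 - t) *\<^sub>R g u + t *\<^sub>R g v - g ((1 - t) *\<^sub>R u + t *\<^sub>R v))"
    using assms by (simp add: cone_le_def dual_cone_def)
  then show "y \<bullet> g ((1 - t) *\<^sub>R u + t *\<^sub>R v) \<le> (1 - t) * (y \<bullet> g u) + t * (y \<bullet> g v)"
    by (simp add: inner_diff_right inner_add_right)
qed (rule X_convex)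

lemma fr_has_derivative:
  assumes "x \<in> \<Omega>" shows "(fr has_derivative (\<lambda>h. h \<bullet> grad f x)) (at x)"
proof -
  from f_smooth(1) assms obtain D where D: "(fr has_derivative D) (at x)"
    by (auto simp: cont_diff_fun_on_def differentiable_def)
  then have lin: "linear D" by (rule has_derivative_linear)
  have "D h = h \<bullet> adjoint D 1" for h
    using adjoint_works[OF lin, of h 1] by simp
  then have "D = (\<lambda>h. h \<bullet> adjoint D 1)" by (rule ext)
  then have G: "GDERIV fr x :> adjoint D 1" using D by (simp add: gderiv_def)
  from grad_eqI[OF G] have "grad f x = adjoint D 1" .
  then show ?thesis using G by (simp add: gderiv_def)
qed

lemma g_has_derivative: "x \<in> \<Omega> \<Longrightarrow> (g has_derivative jac x) (at x)"
  using g_smooth(1) by (simp add: cont_diff_map_on_def frechet_derivative_works)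

lemma linear_jac: "x \<in> \<Omega> \<Longrightarrow> linear (jac x)"
  using g_has_derivative has_derivative_linear by blast

lemma inner_grad_map: "x \<in> \<Omega> \<Longrightarrow> h \<bullet> grad_map g x y = y \<bullet> jac x h"
  unfolding grad_map_def using adjoint_works[OF linear_jac] by (metis inner_commute)

lemma smooth_has_derivative:
  assumes "x \<in> \<Omega>" "0 < r"
  shows "(smooth \<mu> r has_derivative (\<lambda>h. h \<bullet> smooth_grad \<mu> r x)) (at x)"
proof -
  have "((\<lambda>x. \<mu> + r *\<^sub>R g x) has_derivative (\<lambda>h. r *\<^sub>R jac x h)) (at x)"
    using g_has_derivative[OF assms(1)] by (auto intro!: derivative_eq_intros)
  from has_derivative_compose[OF this has_derivative_half_sq_proj_dual_cone]
  have "((\<lambda>x. (norm (proj (\<mu> + r *\<^sub>R g x)))\<^sup>2 / 2) has_derivative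
      (\<lambda>h. proj (\<mu> + r *\<^sub>R g x) \<bullet> (r *\<^sub>R jac x h))) (at x)" .
  then have "((\<lambda>x. fr x + 1 / r * ((norm (proj (\<mu> + r *\<^sub>R g x)))\<^sup>2 / 2)) has_derivative
      (\<lambda>h. h \<bullet> grad f x + 1 / r * (proj (\<mu> + r *\<^sub>R g x) \<bullet> (r *\<^sub>R jac x h)))) (at x)"
    by (intro has_derivative_add fr_has_derivative[OF assms(1)] has_derivative_mult_right)
  moreover have "(\<lambda>x. fr x + 1 / r * ((norm (proj (\<mu> + r *\<^sub>R g x)))\<^sup>2 / 2)) = smooth \<mu> r"
    using assms(2) by (auto simp: smooth_def)
  moreover have "(\<lambda>h. h \<bullet> grad f x + 1 / r * (proj (\<mu> + r *\<^sub>R g x) \<bullet> (r *\<^sub>R jac x h)))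
      = (\<lambda>h. h \<bullet> smooth_grad \<mu> r x)"
    using assms by (auto simp: smooth_grad_def inner_add_right inner_grad_map)
  ultimately show ?thesis by simp
qed

lemma smooth_part_eq:
  assumes "x \<in> \<Omega>" shows "smooth_part f g K \<mu> r x = ereal (smooth \<mu> r x)"
  unfolding smooth_part_def smooth_def
  by (subst f_finite[OF assms]) (simp add: infdist_neg_cone[OF K])

lemma grad_smooth_part:
  assumes "x \<in> \<Omega>" "0 < r" shows "grad (smooth_part f g K \<mu> r) x = smooth_grad \<mu> r x"
proof -
  have "((\<lambda>y. real_of_ereal (smooth_part f g K \<mu> r y)) has_derivative (\<lambda>h. h \<bullet> smooth_grad \<mu> r x)) (at x)"
    by (rule has_derivative_transform_within_open[OF smooth_has_derivative[OF assms] \<Omega>(1) assms(1)])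
       (simp add: smooth_part_eq)
  then have "GDERIV (\<lambda>y. real_of_ereal (smooth_part f g K \<mu> r y)) x :> smooth_grad \<mu> r x"
    by (simp add: gderiv_def)
  then show ?thesis by (rule grad_eqI)
qed

lemma fr_lower: "x \<in> X \<Longrightarrow> y \<in> X \<Longrightarrow> fr x + (y - x) \<bullet> grad f x \<le> fr y"
  using convex_on_above_tangent[OF fr_convex _ _ fr_has_derivative] \<Omega>(2) by blast

lemma g_lower:
  assumes "\<mu> \<in> dual_cone K" "x \<in> X" "y \<in> X"
  shows "\<mu> \<bullet> g x + (y - x) \<bullet> grad_map g x \<mu> \<le> \<mu> \<bullet> g y"
proof -
  have x: "x \<in> \<Omega>" using assms \<Omega> by blast
  have "((\<lambda>x. \<mu> \<bullet> g x) has_derivative (\<lambda>h. \<mu> \<bullet> jac x h)) (at x)"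
    by (rule has_derivative_inner_right[OF g_has_derivative[OF x]])
  from convex_on_above_tangent[OF inner_g_convex[OF assms(1)] assms(2,3) this]
  show ?thesis by (simp add: inner_grad_map[OF x])
qed

text \<open>The penalty term is convex because its gradient with respect to the constraint value lies in the
  dual cone, and \<open>K\<close>-convex maps become convex when paired with elements of the dual cone.\<close>

lemma smooth_lower:
  assumes "x \<in> X" "y \<in> X" "0 < r"
  shows "smooth \<mu> r x + smooth_grad \<mu> r x \<bullet> (y - x) \<le> smooth \<mu> r y"
proof -
  let ?u = "\<lambda>x. \<mu> + r *\<^sub>R g x"
  have "(norm (proj (?u x)))\<^sup>2 + 2 * (proj (?u x) \<bullet> (?u y - ?u x)) \<le> (norm (proj (?u y)))\<^sup>2"
    using norm_proj_dual_cone_convex_smooth(1)[of K "?u x" "?u y"]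
      zero_le_power2[of "norm (proj (?u y) - proj (?u x))"] by linarith
  also have "proj (?u x) \<bullet> (?u y - ?u x) = r * (proj (?u x) \<bullet> g y - proj (?u x) \<bullet> g x)"
    by (simp add: algebra_simps)
  finally have "((norm (proj (?u x)))\<^sup>2 + 2 * (r * (proj (?u x) \<bullet> g y - proj (?u x) \<bullet> g x))) / (2 * r)
      \<le> (norm (proj (?u y)))\<^sup>2 / (2 * r)"
    using assms(3) by (intro divide_right_mono) auto
  then have "(norm (proj (?u x)))\<^sup>2 / (2 * r) + (proj (?u x) \<bullet> g y - proj (?u x) \<bullet> g x)
      \<le> (norm (proj (?u y)))\<^sup>2 / (2 * r)"
    using assms(3) by (simp add: add_divide_distrib)
  moreover have "proj (?u x) \<bullet> g x + (y - x) \<bullet> grad_map g x (proj (?u x)) \<le> proj (?u x) \<bullet> g y"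
    by (intro g_lower closest_point_dual_cone assms)
  moreover note fr_lower[OF assms(1,2)]
  ultimately show ?thesis
    unfolding smooth_def smooth_grad_def inner_commute[of _ "y - x"] inner_add_right by linarith
qed

lemma norm_g_le: "x \<in> X \<Longrightarrow> norm (g x) \<le> M_g"
proof -
  have "continuous_on X g" using L_g by (rule lipschitz_on_continuous_on)
  then have "bdd_above ((\<lambda>x. norm (g x)) ` X)"
    using dom_P by (intro bounded_imp_bdd_above compact_imp_bounded compact_continuous_image continuous_intros)
  then show "x \<in> X \<Longrightarrow> norm (g x) \<le> M_g" unfolding M_g by (rule cSUP_upper[rotated])
qed

lemma constants_nonneg: "0 \<le> L_f" "0 \<le> L_dg" "0 \<le> L_g" "0 \<le> M_g" "0 \<le> D_X"
proof -
  show "0 \<le> L_f" "0 \<le> L_g" using f_smooth(2) L_g by (auto intro: lipschitz_on_nonneg)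
  show "0 \<le> L_dg" using g_smooth(2) by (simp add: grad_map_lipschitz_on_def)
  obtain x where "x \<in> X" using X_nonempty by blast
  from norm_g_le[OF this] show "0 \<le> M_g" using norm_ge_zero order_trans by blast
  show "0 \<le> D_X" unfolding D_X using dom_P compact_imp_bounded by (intro diameter_ge_0) auto
qed

lemma norm_diff_le: "x \<in> X \<Longrightarrow> y \<in> X \<Longrightarrow> norm (x - y) \<le> D_X"
  unfolding D_X dist_norm[symmetric] using dom_P by (intro diameter_bounded_bound compact_imp_bounded)

lemma lip_nonneg: "0 < r \<Longrightarrow> 0 \<le> lip \<mu> r"
  using constants_nonneg by (simp add: smooth_lip_def)

text \<open>The Lipschitz constant of \<open>g\<close> on the domain of \<open>P\<close> controls the Jacobian only along the
  directions in which the domain extends.\<close>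

definition directions :: "'a set" where
  "directions = span ((\<lambda>(x, y). x - y) ` (X \<times> X))"

lemma diff_in_directions: "x \<in> X \<Longrightarrow> y \<in> X \<Longrightarrow> x - y \<in> directions"
  unfolding directions_def by (rule span_base) auto

text \<open>From any \<open>y\<close>, two segments towards relatively interior points that differ by a multiple of
  \<open>u\<close> stay in the domain; the difference quotient of \<open>g\<close> between them tends to the derivative
  along \<open>u\<close>.\<close>

lemma norm_jac_le:
  assumes y: "y \<in> X" and u: "u \<in> directions"
  shows "norm (jac y u) \<le> L_g * norm u"
proof (cases "u = 0")
  case True
  then show ?thesis using linear_jac y \<Omega>(2) linear_0 by (simp add: subset_eq linear_0)
next
  case False
  have y\<Omega>: "y \<in> \<Omega>" using y \<Omega> by blast
  obtain x0 where "x0 \<in> rel_interior X"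
    using X_convex X_nonempty rel_interior_eq_empty by blast
  then obtain e where x0: "x0 \<in> X" and e: "0 < e" "cball x0 e \<inter> affine hull X \<subseteq> X"
    unfolding mem_rel_interior_cball by blast
  define t where "t = e / norm u"
  have t: "0 < t" using e False by (simp add: t_def)
  define x1 where "x1 = x0 + t *\<^sub>R u"
  have "directions \<subseteq> span ((\<lambda>x. - x0 + x) ` X)"
    unfolding directions_def
  proof (rule span_minimal)
    show "(\<lambda>(x, y). x - y) ` (X \<times> X) \<subseteq> span ((\<lambda>x. - x0 + x) ` X)"
    proof safe
      fix a b assume "a \<in> X" "b \<in> X"
      then have "(- x0 + a) - (- x0 + b) \<in> span ((\<lambda>x. - x0 + x) ` X)"
        by (intro span_diff span_base) auto
      then show "a - b \<in> span ((\<lambda>x. - x0 + x) ` X)" by simp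
    qed
  qed (rule subspace_span)
  then have "t *\<^sub>R u \<in> span ((\<lambda>x. - x0 + x) ` X)" using u by (intro span_scale) blast
  then have "x1 \<in> affine hull X"
    unfolding x1_def using x0 by (subst affine_hull_span_gen[of x0]) (auto intro: hull_inc)
  moreover have "x1 \<in> cball x0 e" using e False by (simp add: x1_def t_def dist_norm)
  ultimately have x1: "x1 \<in> X" using e by blast
  define w where "w = jac y u"
  let ?G = "\<lambda>s. w \<bullet> g (y + s *\<^sub>R (x1 - y)) - w \<bullet> g (y + s *\<^sub>R (x0 - y))"
  have "((\<lambda>x. w \<bullet> g x) has_derivative (\<lambda>h. w \<bullet> jac y h)) (at y)"
    by (rule has_derivative_inner_right[OF g_has_derivative[OF y\<Omega>]])
  then have "((\<lambda>s. w \<bullet> g (y + s *\<^sub>R d)) has_real_derivative w \<bullet> jac y d) (at 0)" for d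
    by (intro has_derivative_along_line[of "\<lambda>x. w \<bullet> g x" "\<lambda>h. w \<bullet> jac y h"]) simp
  then have "(?G has_real_derivative w \<bullet> jac y (x1 - y) - w \<bullet> jac y (x0 - y)) (at 0)"
    by (intro DERIV_diff)
  moreover have "w \<bullet> jac y (x1 - y) - w \<bullet> jac y (x0 - y) = t * (norm w)\<^sup>2"
    using linear_jac[OF y\<Omega>] unfolding x1_def w_def power2_norm_eq_inner
    by (simp add: linear_diff linear_add linear_cmul algebra_simps)
  ultimately have "(?G has_real_derivative t * (norm w)\<^sup>2) (at 0)" by simp
  then have "t * (norm w)\<^sup>2 \<le> norm w * (L_g * (t * norm u))"
  proof (rule right_derivative_le)
    fix s :: real assume s: "0 < s" "s < 1"
    let ?a = "y + s *\<^sub>R (x0 - y)" and ?b = "y + s *\<^sub>R (x1 - y)"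
    have "?a \<in> X" "?b \<in> X" using s y x0 x1 X_convex by (auto intro!: convex_segment_in)
    then have "norm (g ?b - g ?a) \<le> L_g * norm (?b - ?a)"
      using lipschitz_onD[OF L_g, of ?b ?a] by (simp only: dist_norm)
    also have "?b - ?a = (s * t) *\<^sub>R u" by (simp add: x1_def algebra_simps)
    finally have "norm w * norm (g ?b - g ?a) \<le> norm w * (L_g * (s * t * norm u))"
      using s t by (intro mult_left_mono) (auto simp: abs_mult)
    moreover have "w \<bullet> (g ?b - g ?a) \<le> norm w * norm (g ?b - g ?a)" by (rule norm_cauchy_schwarz)
    ultimately show "?G s \<le> ?G 0 + s * (norm w * (L_g * (t * norm u)))"
      by (simp add: inner_diff_right mult_ac)
  qed
  then have "t * norm w * norm w \<le> t * norm w * (L_g * norm u)"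
    by (simp add: power2_eq_square mult_ac)
  then show ?thesis
    using t constants_nonneg(3) unfolding w_def[symmetric]
    by (cases "w = 0") (auto simp: mult_le_cancel_left)
qed

text \<open>The three terms of the Lipschitz constant stem from the gradient of \<open>f\<close>, from the variation of the
  Jacobian at a fixed multiplier, and from the variation of the multiplier.\<close>

lemma smooth_grad_lipschitz:
  assumes x: "x \<in> X" and y: "y \<in> X" and r: "0 < r" and u: "u \<in> directions"
  shows "u \<bullet> (smooth_grad \<mu> r x - smooth_grad \<mu> r y) \<le> lip \<mu> r * norm (x - y) * norm u"
proof -
  define p where "p x = proj (\<mu> + r *\<^sub>R g x)" for x
  have x\<Omega>: "x \<in> \<Omega>" and y\<Omega>: "y \<in> \<Omega>" using x y \<Omega> by auto
  have lin: "linear (grad_map g x)" if "x \<in> \<Omega>" for x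
    unfolding grad_map_def by (rule adjoint_linear[OF linear_jac[OF that]])
  have "u \<bullet> (grad f x - grad f y) \<le> norm u * (L_f * norm (x - y))"
    using norm_cauchy_schwarz[of u "grad f x - grad f y"]
      mult_left_mono[OF lipschitz_onD[OF f_smooth(2) x\<Omega> y\<Omega>], of "norm u"]
    by (simp add: dist_norm)
  moreover have "u \<bullet> (grad_map g x (p x) - grad_map g y (p x))
      \<le> norm u * (L_dg * norm (x - y) * (norm \<mu> + r * M_g))"
  proof -
    have "bounded_linear (\<lambda>v. grad_map g x v - grad_map g y v)"
      by (intro linear_conv_bounded_linear[THEN iffD1] linear_compose_sub lin x\<Omega> y\<Omega>)
    then have "norm (grad_map g x (p x) - grad_map g y (p x))
        \<le> onorm (\<lambda>v. grad_map g x v - grad_map g y v) * norm (p x)"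
      by (rule onorm)
    also have "\<dots> \<le> (L_dg * norm (x - y)) * (norm \<mu> + r * M_g)"
    proof (rule mult_mono)
      show "onorm (\<lambda>v. grad_map g x v - grad_map g y v) \<le> L_dg * norm (x - y)"
        using g_smooth(2) x\<Omega> y\<Omega> by (simp add: grad_map_lipschitz_on_def dist_norm)
      have "norm (p x) \<le> norm (\<mu> + r *\<^sub>R g x)"
        unfolding p_def by (rule norm_proj_dual_cone_convex_smooth(4))
      also have "\<dots> \<le> norm \<mu> + norm (r *\<^sub>R g x)" by (rule norm_triangle_ineq)
      also have "norm (r *\<^sub>R g x) \<le> r * M_g" using r norm_g_le[OF x] by simp
      finally show "norm (p x) \<le> norm \<mu> + r * M_g" by simp
    qed (use constants_nonneg in auto)
    finally have "norm u * norm (grad_map g x (p x) - grad_map g y (p x))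
        \<le> norm u * (L_dg * norm (x - y) * (norm \<mu> + r * M_g))" by (rule mult_left_mono) simp
    then show ?thesis
      using norm_cauchy_schwarz[of u "grad_map g x (p x) - grad_map g y (p x)"] by linarith
  qed
  moreover have "u \<bullet> (grad_map g y (p x) - grad_map g y (p y)) \<le> norm u * (r * L_g\<^sup>2 * norm (x - y))"
  proof -
    have "u \<bullet> (grad_map g y (p x) - grad_map g y (p y)) = (p x - p y) \<bullet> jac y u"
      by (simp add: inner_diff_right inner_diff_left inner_grad_map[OF y\<Omega>])
    also have "\<dots> \<le> norm (p x - p y) * norm (jac y u)" by (rule norm_cauchy_schwarz)
    also have "\<dots> \<le> (r * (L_g * norm (x - y))) * (L_g * norm u)"
    proof (rule mult_mono)
      have "norm (p x - p y) \<le> norm ((\<mu> + r *\<^sub>R g x) - (\<mu> + r *\<^sub>R g y))"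
        unfolding p_def by (rule norm_proj_dual_cone_convex_smooth(3))
      also have "(\<mu> + r *\<^sub>R g x) - (\<mu> + r *\<^sub>R g y) = r *\<^sub>R (g x - g y)" by (simp add: algebra_simps)
      finally have "norm (p x - p y) \<le> r * norm (g x - g y)" using r by simp
      also have "norm (g x - g y) \<le> L_g * norm (x - y)"
        using lipschitz_onD[OF L_g x y] by (simp add: dist_norm)
      finally show "norm (p x - p y) \<le> r * (L_g * norm (x - y))" using r by simp
    qed (use norm_jac_le[OF y u] constants_nonneg r in auto)
    finally show ?thesis by (simp add: power2_eq_square mult_ac)
  qed
  moreover have "u \<bullet> (smooth_grad \<mu> r x - smooth_grad \<mu> r y) = u \<bullet> (grad f x - grad f y)
      + u \<bullet> (grad_map g x (p x) - grad_map g y (p x)) + u \<bullet> (grad_map g y (p x) - grad_map g y (p y))"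
    unfolding smooth_grad_def p_def by (simp add: algebra_simps)
  moreover have "norm u * (L_f * norm (x - y)) + norm u * (L_dg * norm (x - y) * (norm \<mu> + r * M_g))
      + norm u * (r * L_g\<^sup>2 * norm (x - y)) = lip \<mu> r * norm (x - y) * norm u"
    unfolding smooth_lip_def by (simp add: algebra_simps)
  ultimately show ?thesis by linarith
qed

lemma smooth_upper:
  assumes "x \<in> X" "y \<in> X" "0 < r"
  shows "smooth \<mu> r y \<le> smooth \<mu> r x + smooth_grad \<mu> r x \<bullet> (y - x) + lip \<mu> r / 2 * (norm (y - x))\<^sup>2"
proof (rule descent_bound[OF X_convex assms(1,2)])
  show "(smooth \<mu> r has_derivative (\<lambda>h. h \<bullet> smooth_grad \<mu> r w)) (at w)" if "w \<in> X" for w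
    using that \<Omega>(2) assms(3) by (intro smooth_has_derivative) auto
  show "(y - x) \<bullet> (smooth_grad \<mu> r w - smooth_grad \<mu> r v) \<le> lip \<mu> r * norm (w - v) * norm (y - x)"
    if "v \<in> X" "w \<in> X" for v w
    using that assms by (intro smooth_grad_lipschitz diff_in_directions)
qed

section \<open>Augmented Lagrangian and proximal point steps\<close>

lemma auglag_min:
  assumes "0 < r"
  shows "auglag_min \<mu> r \<in> X" "y \<in> X \<Longrightarrow> auglag \<mu> r (auglag_min \<mu> r) \<le> auglag \<mu> r y"
proof -
  have "smooth \<mu> r differentiable (at x)" if "x \<in> X" for x
    using smooth_has_derivative[OF subsetD[OF \<Omega>(2) that] assms] by (rule differentiableI)
  then have "continuous_on X (smooth \<mu> r)"
    by (intro continuous_at_imp_continuous_on ballI differentiable_imp_continuous_within)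
  then obtain z where "z \<in> X" "\<And>w. w \<in> X \<Longrightarrow> smooth \<mu> r z + Pr z \<le> smooth \<mu> r w + Pr w"
    using closed_epigraph_attains_min[OF P dom_P] by blast
  then have "\<exists>x. x \<in> X \<and> (\<forall>y\<in>X. auglag \<mu> r x \<le> auglag \<mu> r y)" by (auto simp: auglag_def)
  from someI_ex[OF this] show "auglag_min \<mu> r \<in> X" "y \<in> X \<Longrightarrow> auglag \<mu> r (auglag_min \<mu> r) \<le> auglag \<mu> r y"
    unfolding auglag_min_def by auto
qed

lemma near_min_iff:
  assumes r: "0 < r" and x: "x \<in> X"
  shows "near_min (aug_lagrangian f P g K \<mu> r) \<eta> x \<longleftrightarrow> auglag \<mu> r x - auglag \<mu> r (auglag_min \<mu> r) \<le> \<eta>"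
proof -
  define c where "c = (norm \<mu>)\<^sup>2 / (2 * r)"
  let ?A = "aug_lagrangian f P g K \<mu> r"
  have fin: "?A y = ereal (auglag \<mu> r y - c)" if "y \<in> X" for y
    using that \<Omega>(2) unfolding aug_lagrangian_def
    by (subst P_finite[OF that]) (simp add: subset_eq smooth_part_eq auglag_def c_def)
  have inf: "?A y = \<infinity>" if "y \<notin> X" for y
    using f_not_MInf[of y] by (simp add: aug_lagrangian_def smooth_part_def P_infinite[OF that])
  note m = auglag_min(1)[OF r, of \<mu>] auglag_min(2)[OF r, where \<mu> = \<mu>]
  have "(INF y. ?A y) = ?A (auglag_min \<mu> r)"
  proof (rule antisym)
    show "?A (auglag_min \<mu> r) \<le> (INF y. ?A y)"
    proof (rule INF_greatest)
      fix y show "?A (auglag_min \<mu> r) \<le> ?A y"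
        using m by (cases "y \<in> X") (simp_all add: fin inf)
    qed
  qed (rule INF_lower, simp)
  then show ?thesis by (simp add: near_min_def fin m x)
qed

text \<open>At \<open>xs\<close> the augmented Lagrangian and the ordinary Lagrangian with the updated multiplier have
  the same gradient, so convexity turns optimality for the former into optimality for the latter.\<close>

lemma prox_point_saddle:
  fixes \<mu> r
  defines "xs \<equiv> auglag_min \<mu> r"
  defines "ms \<equiv> proj (\<mu> + r *\<^sub>R g xs)"
  assumes r: "0 < r" and x: "x \<in> X"
  shows "fr xs + Pr xs + ms \<bullet> g xs \<le> fr x + Pr x + ms \<bullet> g x"
proof -
  have xs: "xs \<in> X" unfolding xs_def by (rule auglag_min(1)[OF r])
  have "Pr xs - (x - xs) \<bullet> smooth_grad \<mu> r xs \<le> Pr x"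
  proof (rule minimizer_subgradient[OF Pr_convex xs x])
    show "smooth \<mu> r xs + Pr xs \<le> smooth \<mu> r w + Pr w" if "w \<in> X" for w
      using auglag_min(2)[OF r that, of \<mu>] by (simp add: auglag_def xs_def)
    show "(smooth \<mu> r has_derivative (\<lambda>h. h \<bullet> smooth_grad \<mu> r xs)) (at xs)"
      using xs \<Omega> r by (intro smooth_has_derivative) auto
  qed
  moreover have "fr xs + (x - xs) \<bullet> grad f xs \<le> fr x" by (rule fr_lower[OF xs x])
  moreover have "ms \<bullet> g xs + (x - xs) \<bullet> grad_map g xs ms \<le> ms \<bullet> g x"
    unfolding ms_def by (intro g_lower xs x closest_point_dual_cone)
  ultimately show ?thesis unfolding smooth_grad_def ms_def inner_add_right by linarith
qed

text \<open>The increase of the augmented Lagrangian from \<open>xs\<close> to \<open>x\<close> dominates that of the ordinary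
  Lagrangian with the multiplier of \<open>xs\<close>, which is nonnegative, plus the conjugate gap between the two
  multipliers. Approximate minimization therefore yields an approximate proximal point step.\<close>

lemma multiplier_error:
  fixes \<mu> r
  defines "xs \<equiv> auglag_min \<mu> r"
  assumes r: "0 < r" and x: "x \<in> X"
  shows "(norm (proj (\<mu> + r *\<^sub>R g x) - proj (\<mu> + r *\<^sub>R g xs)))\<^sup>2 \<le> 2 * r * (auglag \<mu> r x - auglag \<mu> r xs)"
proof -
  let ?u = "\<mu> + r *\<^sub>R g x" and ?us = "\<mu> + r *\<^sub>R g xs"
  have "(norm (proj ?us))\<^sup>2 + 2 * (proj ?us \<bullet> (?u - ?us)) + (norm (proj ?u - proj ?us))\<^sup>2 \<le> (norm (proj ?u))\<^sup>2"
    by (rule norm_proj_dual_cone_convex_smooth(1))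
  also have "proj ?us \<bullet> (?u - ?us) = r * (proj ?us \<bullet> g x - proj ?us \<bullet> g xs)"
    by (simp add: algebra_simps)
  finally have a: "(norm (proj ?u - proj ?us))\<^sup>2
      \<le> (norm (proj ?u))\<^sup>2 - (norm (proj ?us))\<^sup>2 - 2 * r * (proj ?us \<bullet> g x - proj ?us \<bullet> g xs)"
    by simp
  have "2 * r * (auglag \<mu> r x - auglag \<mu> r xs)
      = 2 * r * (fr x + Pr x - (fr xs + Pr xs)) + ((norm (proj ?u))\<^sup>2 - (norm (proj ?us))\<^sup>2)"
    using r unfolding auglag_def smooth_def by (simp add: field_simps)
  moreover have "2 * r * (fr xs + Pr xs + proj ?us \<bullet> g xs) \<le> 2 * r * (fr x + Pr x + proj ?us \<bullet> g x)"
    unfolding xs_def by (intro mult_left_mono prox_point_saddle r x) (use r in simp)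
  ultimately show ?thesis using a by (simp add: algebra_simps)
qed

text \<open>The exact multiplier update is a proximal point step for the dual function, hence firmly
  nonexpansive towards dual solutions: weak duality gives \<open>ms \<bullet> g xs \<le> lam \<bullet> g xs\<close>, and
  the projection inequality turns this into an obtuse angle at \<open>ms\<close>.\<close>

lemma prox_point_fejer:
  fixes \<mu> r
  defines "ms \<equiv> proj (\<mu> + r *\<^sub>R g (auglag_min \<mu> r))"
  assumes r: "0 < r" and lam: "lam \<in> dual_solutions f P g K"
  shows "(norm (ms - \<mu>))\<^sup>2 + (norm (ms - lam))\<^sup>2 \<le> (norm (\<mu> - lam))\<^sup>2"
proof -
  define xs where "xs = auglag_min \<mu> r"
  have xs: "xs \<in> X" unfolding xs_def by (rule auglag_min(1)[OF r])
  have ms: "ms \<in> dual_cone K" unfolding ms_def by (rule closest_point_dual_cone)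
  have lagr: "f x + P x + ereal (y \<bullet> g x) = ereal (fr x + Pr x + y \<bullet> g x)" if "x \<in> X" for x y
    using that \<Omega>(2) by (subst P_finite[OF that], subst f_finite) auto
  have "ereal (fr xs + Pr xs + ms \<bullet> g xs) \<le> dual_function f P g ms"
    unfolding dual_function_def
  proof (rule INF_greatest)
    fix x show "ereal (fr xs + Pr xs + ms \<bullet> g xs) \<le> f x + P x + ereal (ms \<bullet> g x)"
    proof (cases "x \<in> X")
      case True
      then show ?thesis
        unfolding lagr[OF True] using prox_point_saddle[OF r True, of \<mu>] by (simp add: ms_def xs_def)
    next
      case False
      then show ?thesis using f_not_MInf[of x] by (simp add: P_infinite)
    qed
  qed
  also have "\<dots> \<le> dual_value f P g K" unfolding dual_value_def using ms by (rule SUP_upper)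
  also have "\<dots> = dual_function f P g lam" using lam by (simp add: dual_solutions_def)
  also have "\<dots> \<le> f xs + P xs + ereal (lam \<bullet> g xs)" unfolding dual_function_def by (rule INF_lower) simp
  finally have "ms \<bullet> g xs \<le> lam \<bullet> g xs" unfolding lagr[OF xs] by simp
  then have "r * (ms \<bullet> g xs) \<le> r * (lam \<bullet> g xs)" using r by simp
  moreover have "ms \<bullet> (\<mu> + r *\<^sub>R g xs) = ms \<bullet> ms"
    unfolding ms_def xs_def by (rule closest_point_dual_cone)
  moreover have "lam \<bullet> (\<mu> + r *\<^sub>R g xs) \<le> lam \<bullet> ms"
    unfolding ms_def xs_def by (rule closest_point_dual_cone) (use lam in \<open>simp add: dual_solutions_def\<close>)
  ultimately have "ms \<bullet> ms + lam \<bullet> \<mu> \<le> ms \<bullet> \<mu> + lam \<bullet> ms" by (simp add: inner_add_right)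
  then show ?thesis by (simp add: power2_norm_eq_inner algebra_simps inner_commute)
qed

section \<open>Inner iterations\<close>

lemma inner_step_iff:
  assumes r: "0 < r" and xz: "x \<in> X" "z \<in> X"
  shows "inner_step (smooth_part f g K \<mu> r) P L j x z x' z' \<longleftrightarrow>
    (let y = (1 / (real j + 2)) *\<^sub>R (real j *\<^sub>R x + 2 *\<^sub>R z) in
      z' \<in> X \<and> (\<forall>w\<in>X. smooth_grad \<mu> r y \<bullet> z' + L / (real j + 2) * (norm (z' - z))\<^sup>2 + Pr z'
          \<le> smooth_grad \<mu> r y \<bullet> w + L / (real j + 2) * (norm (w - z))\<^sup>2 + Pr w)) \<and>
      x' = (1 / (real j + 2)) *\<^sub>R (real j *\<^sub>R x + 2 *\<^sub>R z')"
proof -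
  define y where "y = (1 / (real j + 2)) *\<^sub>R (real j *\<^sub>R x + 2 *\<^sub>R z)"
  have "y = (real j / (real j + 2)) *\<^sub>R x + (2 / (real j + 2)) *\<^sub>R z"
    by (simp add: y_def scaleR_add_right)
  moreover have "real j / (real j + 2) + 2 / (real j + 2) = 1" by (simp flip: add_divide_distrib)
  ultimately have "y \<in> X" using X_convex xz by (simp only:) (rule convexD, auto)
  then have y: "y \<in> \<Omega>" using \<Omega> by blast
  let ?q = "\<lambda>w. smooth \<mu> r y + smooth_grad \<mu> r y \<bullet> (w - y) + L / (real j + 2) * (norm (w - z))\<^sup>2"
  have "is_arg_min (\<lambda>w. smooth_part f g K \<mu> r y + ereal (grad (smooth_part f g K \<mu> r) y \<bullet> (w - y)) + P w
      + ereal (L / (real j + 2) * (norm (w - z))\<^sup>2)) (\<lambda>_. True) z' \<longleftrightarrow>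
    z' \<in> X \<and> (\<forall>w\<in>X. ?q z' + 1 * Pr z' \<le> ?q w + 1 * Pr w)"
  proof (rule is_arg_min_ereal_iff[OF P])
    fix w
    show "smooth_part f g K \<mu> r y + ereal (grad (smooth_part f g K \<mu> r) y \<bullet> (w - y)) + P w
      + ereal (L / (real j + 2) * (norm (w - z))\<^sup>2) = ereal (?q w) + ereal 1 * P w"
      unfolding smooth_part_eq[OF y] grad_smooth_part[OF y r] by (cases "P w") auto
  qed simp
  then show ?thesis
    unfolding inner_step_def Let_def y_def[symmetric]
    by (simp add: inner_diff_right add.assoc conj_assoc)
qed

lemma inner_step_exists:
  assumes r: "0 < r" and xz: "x \<in> X" "z \<in> X"
  shows "\<exists>x' z'. inner_step (smooth_part f g K \<mu> r) P L j x z x' z'"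
proof -
  define y where "y = (1 / (real j + 2)) *\<^sub>R (real j *\<^sub>R x + 2 *\<^sub>R z)"
  have "continuous_on X (\<lambda>w. smooth_grad \<mu> r y \<bullet> w + L / (real j + 2) * (norm (w - z))\<^sup>2)"
    by (intro continuous_intros)
  then obtain z' where "z' \<in> X" "\<And>w. w \<in> X \<Longrightarrow>
      smooth_grad \<mu> r y \<bullet> z' + L / (real j + 2) * (norm (z' - z))\<^sup>2 + Pr z'
      \<le> smooth_grad \<mu> r y \<bullet> w + L / (real j + 2) * (norm (w - z))\<^sup>2 + Pr w"
    using closed_epigraph_attains_min[OF P dom_P] by blast
  then show ?thesis
    unfolding inner_step_iff[OF assms] Let_def y_def by blast
qed

text \<open>The potential is bounded from the first iteration on, whatever the objective value of the
  starting point, since that value enters the first step with weight \<open>0\<close>.\<close>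

definition inner_inv :: "'b \<Rightarrow> real \<Rightarrow> nat \<Rightarrow> 'a \<Rightarrow> 'a \<Rightarrow> bool" where
  "inner_inv \<mu> r j x z \<longleftrightarrow> x \<in> X \<and> z \<in> X \<and>
     (0 < j \<longrightarrow> (real j + 1)\<^sup>2 * (auglag \<mu> r x - auglag \<mu> r (auglag_min \<mu> r))
        + 2 * lip \<mu> r * (norm (z - auglag_min \<mu> r))\<^sup>2 \<le> 2 * lip \<mu> r * D_X\<^sup>2)"

lemma inner_inv_start: "x \<in> X \<Longrightarrow> inner_inv \<mu> r 0 x x"
  by (simp add: inner_inv_def)

lemma inner_inv_step:
  assumes r: "0 < r" and inv: "inner_inv \<mu> r j x z"
    and step: "inner_step (smooth_part f g K \<mu> r) P (lip \<mu> r) j x z x' z'"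
  shows "inner_inv \<mu> r (Suc j) x' z'"
proof -
  define u where "u = auglag_min \<mu> r"
  define y where "y = (1 / (real j + 2)) *\<^sub>R (real j *\<^sub>R x + 2 *\<^sub>R z)"
  define E where "E x = auglag \<mu> r x - auglag \<mu> r u" for x
  have xz: "x \<in> X" "z \<in> X" using inv by (auto simp: inner_inv_def)
  have u: "u \<in> X" unfolding u_def by (rule auglag_min(1)[OF r])
  have E: "0 \<le> E x" using auglag_min(2)[OF r xz(1), of \<mu>] by (simp add: E_def u_def)
  from step have z': "z' \<in> X" and min: "\<And>w. w \<in> X \<Longrightarrow>
      smooth_grad \<mu> r y \<bullet> z' + lip \<mu> r / (real j + 2) * (norm (z' - z))\<^sup>2 + Pr z'
      \<le> smooth_grad \<mu> r y \<bullet> w + lip \<mu> r / (real j + 2) * (norm (w - z))\<^sup>2 + Pr w"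
    and x': "x' = (1 / (real j + 2)) *\<^sub>R (real j *\<^sub>R x + 2 *\<^sub>R z')"
    unfolding inner_step_iff[OF r xz] Let_def y_def by blast+
  note acc = accelerated_step[where G = "smooth_grad \<mu> r" and \<phi> = "smooth \<mu> r",
      OF Pr_convex xz z' u lip_nonneg[OF r] smooth_lower[OF _ _ r] smooth_upper[OF _ _ r] y_def x' min]
  have "(real j + 2)\<^sup>2 * E x' + 2 * lip \<mu> r * (norm (z' - u))\<^sup>2
      \<le> real j * (real j + 2) * E x + 2 * lip \<mu> r * (norm (z - u))\<^sup>2"
    using acc(3) unfolding E_def auglag_def by simp
  also have "\<dots> \<le> 2 * lip \<mu> r * D_X\<^sup>2"
  proof (cases "j = 0")
    case True
    then show ?thesis
      using norm_diff_le[OF xz(2) u] lip_nonneg[OF r] by (auto intro!: mult_left_mono power_mono)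
  next
    case False
    have "real j * (real j + 2) * E x \<le> (real j + 1)\<^sup>2 * E x"
      using E by (intro mult_right_mono) (auto simp: power2_eq_square algebra_simps)
    then show ?thesis using inv False by (simp add: inner_inv_def E_def u_def)
  qed
  finally show ?thesis
    using acc(2) z' by (simp add: inner_inv_def E_def u_def add.commute)
qed

lemma inner_inv_count:
  assumes r: "0 < r" and inv: "inner_inv \<mu> r j x z" and L: "lip \<mu> r \<le> L" and e: "0 < e"
    and far: "e < auglag \<mu> r x - auglag \<mu> r (auglag_min \<mu> r)"
  shows "real (Suc j) \<le> 1 + D_X * sqrt (2 * L / e)"
proof (cases "j = 0")
  case True
  have "0 \<le> L" using L lip_nonneg[OF r, of \<mu>] by linarith
  then show ?thesis using True constants_nonneg e by simp
next
  case False
  have "(real j + 1)\<^sup>2 * e \<le> (real j + 1)\<^sup>2 * (auglag \<mu> r x - auglag \<mu> r (auglag_min \<mu> r))"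
    using far by (intro mult_left_mono) auto
  also have "\<dots> \<le> (real j + 1)\<^sup>2 * (auglag \<mu> r x - auglag \<mu> r (auglag_min \<mu> r))
      + 2 * lip \<mu> r * (norm (z - auglag_min \<mu> r))\<^sup>2" using mult_nonneg_nonneg[OF lip_nonneg[OF r] zero_le_power2] by simp
  also have "\<dots> \<le> 2 * lip \<mu> r * D_X\<^sup>2" using inv False by (simp add: inner_inv_def)
  also have "\<dots> \<le> 2 * L * D_X\<^sup>2" using L by (intro mult_right_mono) auto
  finally have "(real j + 1)\<^sup>2 \<le> 2 * L / e * D_X\<^sup>2" using e by (simp add: field_simps)
  then have "real j + 1 \<le> sqrt (2 * L / e * D_X\<^sup>2)" by (rule real_le_rsqrt)
  also have "\<dots> = D_X * sqrt (2 * L / e)" unfolding real_sqrt_mult using constants_nonneg by simp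
  finally show ?thesis by simp
qed

text \<open>If the Lipschitz constant vanishes, then so does the bound on the potential, and a single
  iteration is exact. This settles the degenerate postprocessing accuracy \<open>0\<close>.\<close>

lemma inner_inv_exact:
  assumes r: "0 < r" and inv: "inner_inv \<mu> r j x z" and L: "lip \<mu> r = 0"
    and far: "0 < auglag \<mu> r x - auglag \<mu> r (auglag_min \<mu> r)"
  shows "j = 0"
proof (rule ccontr)
  assume "j \<noteq> 0"
  then have "(real j + 1)\<^sup>2 * (auglag \<mu> r x - auglag \<mu> r (auglag_min \<mu> r)) \<le> 0"
    using inv L by (simp add: inner_inv_def)
  moreover have "0 < (real j + 1)\<^sup>2 * (auglag \<mu> r x - auglag \<mu> r (auglag_min \<mu> r))"
    using far by (intro mult_pos_pos) (auto simp: add_pos_nonneg)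
  ultimately show False by simp
qed

section \<open>Postprocessing\<close>

lemma prox_grad_step_exists:
  assumes r: "0 < r" and x: "x \<in> X"
  shows "\<exists>x'. prox_grad_step f P g K L_f L_dg L_g M_g \<mu> r x x'"
proof -
  define L where "L = lip \<mu> r"
  define c where "c = x - (1 / L) *\<^sub>R grad (smooth_part f g K \<mu> r) x"
  show ?thesis
  proof (cases "L = 0")
    case True
    have "is_arg_min (\<lambda>y. ereal (1 / 2 * (norm (y - c))\<^sup>2) + ereal (1 / L) * P y) (\<lambda>_. True) c"
      using True by (simp add: is_arg_min_def zero_ereal_def[symmetric])
    then show ?thesis unfolding prox_grad_step_def is_prox_def Let_def L_def[symmetric] c_def by blast
  next
    case False
    then have L: "0 < L" using lip_nonneg[OF r, of \<mu>] by (simp add: L_def)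
    have "continuous_on X (\<lambda>y. L * (1 / 2 * (norm (y - c))\<^sup>2))" by (intro continuous_intros)
    then obtain z where z: "z \<in> X" "\<And>w. w \<in> X \<Longrightarrow>
        L * (1 / 2 * (norm (z - c))\<^sup>2) + Pr z \<le> L * (1 / 2 * (norm (w - c))\<^sup>2) + Pr w"
      using closed_epigraph_attains_min[OF P dom_P] by blast
    have "1 / 2 * (norm (z - c))\<^sup>2 + 1 / L * Pr z \<le> 1 / 2 * (norm (w - c))\<^sup>2 + 1 / L * Pr w" if "w \<in> X" for w
      using mult_left_mono[OF z(2)[OF that], of "1 / L"] L by (simp add: distrib_left)
    then have "is_arg_min (\<lambda>y. ereal (1 / 2 * (norm (y - c))\<^sup>2) + ereal (1 / L) * P y) (\<lambda>_. True) z"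
      using z(1) L by (subst is_arg_min_ereal_iff[OF P, where c = "1 / L"]) auto
    then show ?thesis unfolding prox_grad_step_def is_prox_def Let_def L_def[symmetric] c_def by blast
  qed
qed

text \<open>The proximal step yields a subgradient of \<open>P\<close> at the new point. If the Lipschitz constant
  vanishes, so that the step is the identity, the same formula is the optimality condition of an
  exact minimizer.\<close>

lemma prox_grad_step_properties:
  fixes \<mu> r x x'
  defines "L \<equiv> lip \<mu> r"
  assumes r: "0 < r" and x: "x \<in> X" and step: "prox_grad_step f P g K L_f L_dg L_g M_g \<mu> r x x'"
    and exact: "L = 0 \<Longrightarrow> auglag \<mu> r x \<le> auglag \<mu> r (auglag_min \<mu> r)"
  shows "x' \<in> X"
    and "u \<in> X \<Longrightarrow> Pr x' + (L *\<^sub>R (x - x') - smooth_grad \<mu> r x) \<bullet> (u - x') \<le> Pr u"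
    and "L / 2 * (norm (x' - x))\<^sup>2 \<le> auglag \<mu> r x - auglag \<mu> r x'"
proof -
  define G where "G = smooth_grad \<mu> r x"
  define c where "c = x - (1 / L) *\<^sub>R G"
  have x\<Omega>: "x \<in> \<Omega>" using x \<Omega> by blast
  have am: "is_arg_min (\<lambda>y. ereal (1 / 2 * (norm (y - c))\<^sup>2) + ereal (1 / L) * P y) (\<lambda>_. True) x'"
    using step unfolding prox_grad_step_def is_prox_def Let_def L_def[symmetric] c_def G_def
      grad_smooth_part[OF x\<Omega> r] .
  have x'X: "x' \<in> X" and sub: "\<And>u. u \<in> X \<Longrightarrow> Pr x' + (L *\<^sub>R (x - x') - G) \<bullet> (u - x') \<le> Pr u"
  proof (atomize (full), cases "L = 0")
    case True
    have "\<not> (1 / 2 * (norm (c - c))\<^sup>2 < 1 / 2 * (norm (x' - c))\<^sup>2)"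
      using am True unfolding is_arg_min_def by (auto simp: zero_ereal_def[symmetric] dest: spec[of _ c])
    then have x'x: "x' = x" using True by (simp add: c_def)
    have "Pr x - G \<bullet> (u - x) \<le> Pr u" if "u \<in> X" for u
    proof -
      have "auglag \<mu> r x \<le> auglag \<mu> r u" using exact[OF True] auglag_min(2)[OF r that, of \<mu>] by linarith
      then show ?thesis
        using smooth_upper[OF x that r, of \<mu>] True unfolding auglag_def L_def G_def by simp
    qed
    then show "x' \<in> X \<and> (\<forall>u. u \<in> X \<longrightarrow> Pr x' + (L *\<^sub>R (x - x') - G) \<bullet> (u - x') \<le> Pr u)"
      using x x'x True by simp
  next
    case False
    then have L: "0 < L" using lip_nonneg[OF r, of \<mu>] by (simp add: L_def)
    from am have x'X: "x' \<in> X" and min: "\<And>w. w \<in> X \<Longrightarrow>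
        1 / 2 * (norm (x' - c))\<^sup>2 + 1 / L * Pr x' \<le> 1 / 2 * (norm (w - c))\<^sup>2 + 1 / L * Pr w"
      using L by (subst (asm) is_arg_min_ereal_iff[OF P, where c = "1 / L"]; auto)+
    have "L * (1 / 2 * (norm (d + (1 / L) *\<^sub>R G))\<^sup>2) = G \<bullet> d + L / 2 * (norm d)\<^sup>2 + (norm G)\<^sup>2 / (2 * L)" for d
      using L unfolding power2_norm_eq_inner
      by (simp add: inner_add_left inner_add_right inner_commute field_simps)
    from this[of "_ - x"] have exp: "L * (1 / 2 * (norm (w - c))\<^sup>2)
        = G \<bullet> w + L / 2 * (norm (w - x))\<^sup>2 + ((norm G)\<^sup>2 / (2 * L) - G \<bullet> x)" for w
      by (simp add: c_def inner_diff_right algebra_simps)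
    have "Pr x' + ((2 * (L / 2)) *\<^sub>R (x - x') - G) \<bullet> (u - x') \<le> Pr u" if "u \<in> X" for u
    proof (rule proximal_minimizer_subgradient[OF Pr_convex x'X that])
      fix w assume "w \<in> X"
      from mult_left_mono[OF min[OF this], of L] L
      have "L * (1 / 2 * (norm (x' - c))\<^sup>2) + Pr x' \<le> L * (1 / 2 * (norm (w - c))\<^sup>2) + Pr w"
        by (simp add: distrib_left)
      then show "G \<bullet> x' + L / 2 * (norm (x' - x))\<^sup>2 + Pr x' \<le> G \<bullet> w + L / 2 * (norm (w - x))\<^sup>2 + Pr w"
        unfolding exp by linarith
    qed
    then show "x' \<in> X \<and> (\<forall>u. u \<in> X \<longrightarrow> Pr x' + (L *\<^sub>R (x - x') - G) \<bullet> (u - x') \<le> Pr u)"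
      using x'X by simp
  qed
  show "x' \<in> X" by (rule x'X)
  show "u \<in> X \<Longrightarrow> Pr x' + (L *\<^sub>R (x - x') - smooth_grad \<mu> r x) \<bullet> (u - x') \<le> Pr u"
    using sub unfolding G_def .
  have "smooth \<mu> r x' \<le> smooth \<mu> r x + G \<bullet> (x' - x) + L / 2 * (norm (x' - x))\<^sup>2"
    unfolding G_def L_def by (rule smooth_upper[OF x x'X r])
  moreover have "(L *\<^sub>R (x - x') - G) \<bullet> (x - x') = L * (norm (x' - x))\<^sup>2 + G \<bullet> (x' - x)"
    unfolding power2_norm_eq_inner by (simp add: algebra_simps inner_commute)
  ultimately show "L / 2 * (norm (x' - x))\<^sup>2 \<le> auglag \<mu> r x - auglag \<mu> r x'"
    using sub[OF x] unfolding auglag_def by simp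
qed

text \<open>The projection residual divided by \<open>r\<close> is a normal vector of the dual cone at \<open>\<mu>'\<close>, at distance
  \<open>\<parallel>\<mu>' - \<mu>\<parallel> / r\<close> from \<open>g x\<close>.\<close>

lemma eps_kktI:
  assumes x: "x \<in> X" and v: "v \<in> subdifferential P x"
    and stat: "norm (grad f x + v + grad_map g x \<mu>') \<le> \<epsilon>"
    and mu: "\<mu>' = proj (\<mu> + r *\<^sub>R g x)" and r: "0 < r" and compl: "norm (\<mu>' - \<mu>) \<le> r * \<epsilon>"
  shows "eps_kkt f P g K \<epsilon> x \<mu>'"
proof -
  let ?A = "(\<lambda>v. grad f x + v + grad_map g x \<mu>') ` subdifferential P x"
  let ?N = "normal_cone (dual_cone K) \<mu>'"
  have mu': "\<mu>' \<in> dual_cone K" unfolding mu by (rule closest_point_dual_cone)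
  have "infdist 0 ?A \<le> dist 0 (grad f x + v + grad_map g x \<mu>')" using v by (intro infdist_le) auto
  then have A: "?A \<noteq> {}" "infdist 0 ?A \<le> \<epsilon>" using v stat by auto
  define n where "n = g x - (1 / r) *\<^sub>R (\<mu>' - \<mu>)"
  have "n \<in> ?N"
    unfolding normal_cone_def
  proof (intro CollectI conjI ballI mu')
    fix y assume "y \<in> dual_cone K"
    from closest_point_dual_cone(3)[OF this, of "\<mu> + r *\<^sub>R g x", folded mu]
      closest_point_dual_cone(2)[of K "\<mu> + r *\<^sub>R g x", folded mu]
    have "(\<mu> + r *\<^sub>R g x - \<mu>') \<bullet> (y - \<mu>') \<le> 0"
      by (simp add: inner_diff_left inner_diff_right inner_commute)
    moreover have "\<mu> + r *\<^sub>R g x - \<mu>' = r *\<^sub>R n" using r by (simp add: n_def algebra_simps)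
    ultimately show "n \<bullet> (y - \<mu>') \<le> 0" using r by (simp add: mult_le_0_iff)
  qed
  moreover have "dist (g x) n \<le> \<epsilon>"
    using r compl by (simp add: n_def dist_norm divide_le_eq mult.commute)
  ultimately have N: "?N \<noteq> {}" "infdist (g x) ?N \<le> \<epsilon>" using infdist_le2 by auto
  show ?thesis unfolding eps_kkt_def Let_def using x mu' A N by blast
qed

text \<open>The components of a gradient error orthogonal to the domain of \<open>P\<close> are absorbed by the
  subdifferential of \<open>P\<close>, so only its component along the domain counts.\<close>

lemma prox_grad_step_stationary:
  fixes \<mu> r x x'
  defines "L \<equiv> lip \<mu> r"
  assumes r: "0 < r" and x: "x \<in> X" and x': "x' \<in> X"
    and sub: "\<And>u. u \<in> X \<Longrightarrow> Pr x' + (L *\<^sub>R (x - x') - smooth_grad \<mu> r x) \<bullet> (u - x') \<le> Pr u"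
  obtains v where "v \<in> subdifferential P x'" "norm (smooth_grad \<mu> r x' + v) \<le> 2 * L * norm (x' - x)"
proof -
  define e where "e = smooth_grad \<mu> r x' - smooth_grad \<mu> r x"
  obtain a b where a: "a \<in> directions" and b: "\<And>w. w \<in> directions \<Longrightarrow> orthogonal b w" and e: "e = a + b"
    using orthogonal_subspace_decomp_exists[of "(\<lambda>(x, y). x - y) ` (X \<times> X)" e]
    unfolding directions_def by blast
  have "norm a * norm a = a \<bullet> e"
    using b[OF a] by (simp add: e inner_add_right orthogonal_def inner_commute power2_norm_eq_inner flip: power2_eq_square)
  also have "\<dots> \<le> L * norm (x' - x) * norm a"
    unfolding e_def L_def by (rule smooth_grad_lipschitz[OF x' x r a])
  finally have na: "norm a \<le> L * norm (x' - x)"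
    using lip_nonneg[OF r, of \<mu>] by (cases "a = 0") (auto simp: L_def)
  define v where "v = L *\<^sub>R (x - x') - smooth_grad \<mu> r x - b"
  have "v \<in> subdifferential P x'"
    unfolding subdifferential_def
  proof safe
    fix u show "P x' + ereal (v \<bullet> (u - x')) \<le> P u"
    proof (cases "u \<in> X")
      case True
      have "b \<bullet> (u - x') = 0" using b diff_in_directions[OF True x'] by (auto simp: orthogonal_def)
      then have "Pr x' + v \<bullet> (u - x') \<le> Pr u" using sub[OF True] by (simp add: v_def inner_diff_left)
      then show ?thesis by (subst P_finite[OF True], subst P_finite[OF x']) simp
    qed (simp add: P_infinite)
  qed
  moreover have "smooth_grad \<mu> r x' + v = L *\<^sub>R (x - x') + a"
    using e by (simp add: v_def e_def algebra_simps)
  moreover have "norm (L *\<^sub>R (x - x') + a) \<le> L * norm (x' - x) + L * norm (x' - x)"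
    using norm_triangle_ineq[of "L *\<^sub>R (x - x')" a] na lip_nonneg[OF r, of \<mu>]
    by (simp add: L_def norm_minus_commute mult.commute)
  ultimately show ?thesis using that by simp
qed

text \<open>The postprocessing accuracy is the minimum of two numbers: one makes the proximal step so short
  that stationarity holds up to \<open>\<epsilon>\<close>, the other keeps the new multiplier close to the one from which the
  subroutine was started.\<close>

lemma postprocessing_eps_kkt:
  fixes \<mu> r x x'
  assumes r: "0 < r" and \<epsilon>: "0 < \<epsilon>" and x: "x \<in> X"
    and acc: "auglag \<mu> r x - auglag \<mu> r (auglag_min \<mu> r) \<le> post_accuracy L_f L_dg L_g M_g \<epsilon> \<mu> r"
    and step: "prox_grad_step f P g K L_f L_dg L_g M_g \<mu> r x x'"
    and x1: "x1 \<in> X" "auglag \<mu> r x1 - auglag \<mu> r (auglag_min \<mu> r) \<le> \<eta>" "\<eta> / r \<le> \<epsilon>\<^sup>2 / 128"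
    and small: "1 / r * norm (proj (\<mu> + r *\<^sub>R g x1) - \<mu>) \<le> 3 / 4 * \<epsilon>"
  shows "eps_kkt f P g K \<epsilon> x' (proj (\<mu> + r *\<^sub>R g x'))"
proof -
  define L where "L = lip \<mu> r"
  define m where "m = auglag_min \<mu> r"
  define p where "p x = proj (\<mu> + r *\<^sub>R g x)" for x
  have L0: "0 \<le> L" unfolding L_def by (rule lip_nonneg[OF r])
  have acc1: "auglag \<mu> r x - auglag \<mu> r m \<le> \<epsilon>\<^sup>2 * (1 / (8 * L))"
    and acc2: "auglag \<mu> r x - auglag \<mu> r m \<le> \<epsilon>\<^sup>2 * (r / 128)"
    using acc mult_left_mono[OF min.cobounded1[of "r / 128" "1 / (8 * L)"], of "\<epsilon>\<^sup>2"]
      mult_left_mono[OF min.cobounded2[of "r / 128" "1 / (8 * L)"], of "\<epsilon>\<^sup>2"]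
    by (auto simp: post_accuracy_def L_def m_def)
  have exact: "auglag \<mu> r x \<le> auglag \<mu> r (auglag_min \<mu> r)" if "lip \<mu> r = 0"
    using acc1 that by (simp add: L_def m_def)
  note pg = prox_grad_step_properties[OF r x step exact, simplified, folded L_def]
  obtain v where v: "v \<in> subdifferential P x'" "norm (smooth_grad \<mu> r x' + v) \<le> 2 * L * norm (x' - x)"
    using prox_grad_step_stationary[OF r x pg(1), of \<mu>] pg(2) unfolding L_def by metis
  have dec: "L / 2 * (norm (x' - x))\<^sup>2 \<le> auglag \<mu> r x - auglag \<mu> r m"
    using pg(3) auglag_min(2)[OF r pg(1), of \<mu>] by (simp add: m_def)
  have "2 * L * norm (x' - x) \<le> \<epsilon>"
  proof (cases "L = 0")
    case False
    have "L / 2 * (norm (x' - x))\<^sup>2 * (8 * L) \<le> \<epsilon>\<^sup>2 * (1 / (8 * L)) * (8 * L)"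
      using dec acc1 L0 by (intro mult_right_mono) auto
    then have "(2 * L * norm (x' - x))\<^sup>2 \<le> \<epsilon>\<^sup>2" using False by (simp add: power2_eq_square algebra_simps)
    then show ?thesis using \<epsilon> by (rule power2_le_imp_le[OF _ less_imp_le])
  qed (use \<epsilon> in simp)
  then have stat: "norm (grad f x' + v + grad_map g x' (p x')) \<le> \<epsilon>"
    using v(2) by (simp add: smooth_grad_def p_def algebra_simps)
  (* Both multipliers lie within r \<epsilon> / 8 of the exact one, and 1/8 + 1/8 + 3/4 = 1. *)
  have close: "norm (p w - p m) \<le> r * \<epsilon> / 8"
    if "w \<in> X" "auglag \<mu> r w - auglag \<mu> r m \<le> \<epsilon>\<^sup>2 * (r / 128)" for w
  proof (rule power2_le_imp_le)
    have "(norm (p w - p m))\<^sup>2 \<le> 2 * r * (auglag \<mu> r w - auglag \<mu> r m)"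
      unfolding p_def m_def by (rule multiplier_error[OF r that(1)])
    also have "\<dots> \<le> 2 * r * (\<epsilon>\<^sup>2 * (r / 128))" using that(2) r by (intro mult_left_mono) auto
    finally show "(norm (p w - p m))\<^sup>2 \<le> (r * \<epsilon> / 8)\<^sup>2" by (simp add: power2_eq_square algebra_simps)
  qed (use r \<epsilon> in simp)
  have "0 \<le> L / 2 * (norm (x' - x))\<^sup>2" using L0 by simp
  then have "norm (p x' - p m) \<le> r * \<epsilon> / 8"
    using pg(1,3) acc2 by (intro close) auto
  moreover have "norm (p x1 - p m) \<le> r * \<epsilon> / 8"
    using x1 r by (intro close) (auto simp: m_def field_simps)
  moreover have "norm (p x1 - \<mu>) \<le> r * (3 / 4 * \<epsilon>)" using small r by (simp add: p_def field_simps)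
  moreover have "norm (p x' - \<mu>) \<le> norm (p x' - p m) + norm (p x1 - p m) + norm (p x1 - \<mu>)"
    using norm_triangle_ineq[of "p x' - p m" "p m - \<mu>"] norm_triangle_ineq[of "p m - p x1" "p x1 - \<mu>"]
    by (simp add: norm_minus_commute)
  ultimately have "norm (p x' - \<mu>) \<le> r * \<epsilon>" by simp
  then show ?thesis using eps_kktI[OF pg(1) v(1) stat p_def r] unfolding p_def by simp
qed

end

section \<open>Outer iterations\<close>

lemma sum_inverse_sqrt_le: "(\<Sum>i<n. 1 / sqrt (real i + 1)) \<le> 2 * sqrt (real n)"
proof (induction n)
  case (Suc n)
  define a b where "a = sqrt (real n)" and "b = sqrt (real n + 1)"
  have b: "0 < b" "b\<^sup>2 = a\<^sup>2 + 1" by (simp_all add: a_def b_def)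
  have "0 \<le> (a - b)\<^sup>2" by simp
  then have "2 * a * b + 1 \<le> 2 * b * b" using b(2) by (simp add: power2_eq_square algebra_simps)
  then have "2 * a + 1 / b \<le> 2 * b" using b(1) by (simp add: field_simps)
  then show ?case using Suc by (simp add: a_def b_def add.commute)
qed simp

lemma power_powr_eq:
  assumes "0 < (x::real)" "real n * a = real k" shows "(x ^ n) powr a = x ^ k"
proof -
  have "(x ^ n) powr a = (x powr real n) powr a" using assms by (simp only: powr_realpow)
  also have "\<dots> = x powr real k" unfolding powr_powr assms(2) ..
  finally show ?thesis using assms by (simp only: powr_realpow)
qed

locale alm_setting = smooth_conic_program f P g K \<Omega> L_f L_dg L_g M_g D_X
  for f P :: "'a::euclidean_space \<Rightarrow> ereal"
    and g :: "'a \<Rightarrow> 'b::euclidean_space"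
    and K :: "'b set"
    and \<Omega> :: "'a set"
    and L_f L_dg L_g M_g D_X :: real +
  fixes lam0 lam_hat :: 'b
    and D_\<Lambda> B C \<epsilon> \<rho>0 \<eta>0 :: real
    and \<rho> \<eta> :: "nat \<Rightarrow> real"
  assumes lam_hat: "lam_hat \<in> dual_solutions f P g K"
    and D_\<Lambda>: "D_\<Lambda> = norm (lam0 - lam_hat)"
    and B: "B = L_f + L_dg * (norm lam_hat + D_\<Lambda>)"
    and C: "C = L_dg * M_g + L_g\<^sup>2"
    and \<epsilon>: "\<epsilon> > 0"
    and \<rho>0: "\<rho>0 \<ge> 1"
    and \<eta>0: "0 < \<eta>0" "\<eta>0 \<le> 1"
    and \<rho>: "\<And>k. \<rho> k = \<rho>0 * (real k + 1) powr (3/2)"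
    and \<eta>: "\<And>k. \<eta> k = \<eta>0 * (real k + 1) powr (-5/2) * min 1 (sqrt \<epsilon>)"
begin

text \<open>Eighth roots of \<open>max D\<^sub>\<Lambda> 1\<close> and of the inverse tolerance: their fractional powers in the
  complexity bound are integral powers of these two numbers.\<close>

definition "d = max D_\<Lambda> 1 powr (1/8)"
definition "q = min 1 \<epsilon> powr (-1/8)"

text \<open>Bounds for the multiplier error caused by one inexact inner minimization, and for the distance
  from \<open>lam_hat\<close> after \<open>k\<close> of them.\<close>

definition "drift k = sqrt (2 * \<rho> k * \<eta> k)"

definition "radius k = D_\<Lambda> + (\<Sum>i<k. drift i)"

text \<open>The part of the stopping condition of an outer iteration that depends on the parameters
  only.\<close>

definition "settled k \<longleftrightarrow> \<eta> k / \<rho> k \<le> \<epsilon>\<^sup>2 / 128"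

text \<open>The second conjunct telescopes the firm nonexpansiveness of the exact proximal point steps, each
  of which has length at least \<open>(5/8) \<epsilon> \<rho>\<^sub>i\<close> in a settled iteration that does not stop. Summing squares
  is what makes the number of outer iterations of order \<open>\<epsilon>\<close> to the power \<open>-1/2\<close>; the bound on the
  distance alone would give \<open>-2/3\<close>.\<close>

definition "outer_inv k \<mu> \<longleftrightarrow> norm (\<mu> - lam_hat) \<le> radius k \<and>
  (norm (\<mu> - lam_hat))\<^sup>2 + (\<Sum>i\<in>{i. i < k \<and> settled i}. (5 / 8 * \<epsilon> * \<rho> i)\<^sup>2)
    \<le> D_\<Lambda>\<^sup>2 + 2 * (\<Sum>i<k. radius (Suc i) * drift i)"

lemma \<rho>_pos: "0 < \<rho> k" using \<rho>0 by (simp add: \<rho>)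

lemma \<eta>_pos: "0 < \<eta> k" using \<eta>0 \<epsilon> by (simp add: \<eta>)

lemma drift_nonneg: "0 \<le> drift k" by (simp add: drift_def less_imp_le \<rho>_pos \<eta>_pos)

lemma D_\<Lambda>_nonneg: "0 \<le> D_\<Lambda>" by (simp add: D_\<Lambda>)

lemma radius_nonneg: "0 \<le> radius k"
  by (simp add: radius_def D_\<Lambda>_nonneg sum_nonneg drift_nonneg)

lemma radius_Suc: "radius (Suc k) = radius k + drift k"
  by (simp add: radius_def)

lemma outer_inv_start: "outer_inv 0 lam0"
  unfolding outer_inv_def radius_def using D_\<Lambda> by simp

lemma outer_inv_step:
  fixes k \<mu> x
  defines "\<mu>' \<equiv> proj (\<mu> + \<rho> k *\<^sub>R g x)"
  assumes inv: "outer_inv k \<mu>" and x: "x \<in> X"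
    and near: "auglag \<mu> (\<rho> k) x - auglag \<mu> (\<rho> k) (auglag_min \<mu> (\<rho> k)) \<le> \<eta> k"
    and big: "\<not> small_step \<epsilon> \<rho> \<eta> k \<mu> \<mu>'"
  shows "outer_inv (Suc k) \<mu>'"
proof -
  define ms where "ms = proj (\<mu> + \<rho> k *\<^sub>R g (auglag_min \<mu> (\<rho> k)))"
  define a b a' s where "a = norm (\<mu> - lam_hat)" and "b = norm (ms - lam_hat)"
    and "a' = norm (\<mu>' - lam_hat)" and "s = drift k"
  have nn: "0 \<le> a" "0 \<le> b" "0 \<le> a'" "0 \<le> s" by (auto simp: a_def b_def a'_def s_def drift_nonneg)
  have "(norm (\<mu>' - ms))\<^sup>2 \<le> 2 * \<rho> k * (auglag \<mu> (\<rho> k) x - auglag \<mu> (\<rho> k) (auglag_min \<mu> (\<rho> k)))"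
    unfolding \<mu>'_def ms_def by (rule multiplier_error[OF \<rho>_pos x])
  also have "\<dots> \<le> 2 * \<rho> k * \<eta> k" using near \<rho>_pos[of k] by (intro mult_left_mono) auto
  finally have err: "norm (\<mu>' - ms) \<le> s" unfolding s_def drift_def by (rule real_le_rsqrt)
  have fejer: "(norm (ms - \<mu>))\<^sup>2 + b\<^sup>2 \<le> a\<^sup>2"
    unfolding ms_def a_def b_def by (rule prox_point_fejer[OF \<rho>_pos lam_hat])
  then have "b\<^sup>2 \<le> a\<^sup>2" using zero_le_power2[of "norm (ms - \<mu>)"] by linarith
  then have "b \<le> a" using nn by (rule_tac power2_le_imp_le) auto
  moreover have a'b: "a' \<le> b + s"
    using norm_triangle_ineq[of "\<mu>' - ms" "ms - lam_hat"] err by (simp add: a'_def b_def)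
  ultimately have a'R: "a' \<le> radius (Suc k)"
    using inv by (simp add: outer_inv_def radius_Suc a_def s_def)
  have "a'\<^sup>2 \<le> b\<^sup>2 + 2 * (a' * s)"
  proof (cases "s \<le> a'")
    case True
    then have "(a' - s)\<^sup>2 \<le> b\<^sup>2" using a'b by (intro power_mono) auto
    then have "a'\<^sup>2 + s\<^sup>2 \<le> b\<^sup>2 + 2 * (a' * s)" by (simp add: power2_diff)
    then show ?thesis using zero_le_power2[of s] by linarith
  next
    case False
    then have "a' * a' \<le> a' * s" using nn by (intro mult_left_mono) auto
    moreover have "0 \<le> a' * s" "0 \<le> b * b" using nn by auto
    ultimately show ?thesis unfolding power2_eq_square by linarith
  qed
  also have "a' * s \<le> radius (Suc k) * s" using a'R nn by (intro mult_right_mono) auto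
  finally have main: "a'\<^sup>2 + (norm (ms - \<mu>))\<^sup>2 \<le> a\<^sup>2 + 2 * (radius (Suc k) * s)" using fejer by simp
  (* 5/8 = 3/4 - 1/8: inexactness contributes at most \<rho> k * \<epsilon> / 8 to a displacement that the
     stopping test found larger than 3/4 * \<epsilon> * \<rho> k. *)
  have long: "(5 / 8 * \<epsilon> * \<rho> k)\<^sup>2 \<le> (norm (ms - \<mu>))\<^sup>2" if "settled k"
  proof (rule power_mono)
    have "s \<le> \<rho> k * \<epsilon> / 8"
      unfolding s_def drift_def
    proof (rule real_le_lsqrt)
      show "2 * \<rho> k * \<eta> k \<le> (\<rho> k * \<epsilon> / 8)\<^sup>2"
        using that \<rho>_pos[of k] by (simp add: settled_def power2_eq_square field_simps)
    qed (use \<rho>_pos[of k] \<eta>_pos[of k] \<epsilon> in simp)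
    moreover have "norm (\<mu>' - \<mu>) \<le> norm (\<mu>' - ms) + norm (ms - \<mu>)"
      using norm_triangle_ineq[of "\<mu>' - ms" "ms - \<mu>"] by simp
    moreover have "3 / 4 * \<epsilon> * \<rho> k < norm (\<mu>' - \<mu>)"
      using big that \<rho>_pos[of k] by (simp add: small_step_def settled_def field_simps)
    ultimately show "5 / 8 * \<epsilon> * \<rho> k \<le> norm (ms - \<mu>)" using err by (simp add: mult_ac)
  qed (use \<epsilon> \<rho>_pos[of k] in simp)
  let ?h = "\<lambda>i. (5 / 8 * \<epsilon> * \<rho> i)\<^sup>2"
  have "(\<Sum>i\<in>{i. i < Suc k \<and> settled i}. ?h i)
      \<le> (\<Sum>i\<in>{i. i < k \<and> settled i}. ?h i) + (norm (ms - \<mu>))\<^sup>2"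
  proof (cases "settled k")
    case True
    then have "{i. i < Suc k \<and> settled i} = insert k {i. i < k \<and> settled i}" by (auto simp: less_Suc_eq)
    then show ?thesis using long[OF True] by simp
  next
    case False
    then have "{i. i < Suc k \<and> settled i} = {i. i < k \<and> settled i}" by (auto simp: less_Suc_eq)
    then show ?thesis by simp
  qed
  then have "a'\<^sup>2 + (\<Sum>i\<in>{i. i < Suc k \<and> settled i}. ?h i)
      \<le> D_\<Lambda>\<^sup>2 + 2 * (\<Sum>i<Suc k. radius (Suc i) * drift i)"
    using inv main unfolding outer_inv_def a_def[symmetric] s_def by simp
  then show ?thesis using a'R unfolding outer_inv_def a'_def by simp
qed

lemma budget_le: "D_\<Lambda>\<^sup>2 + 2 * (\<Sum>i<k. radius (Suc i) * drift i) \<le> 2 * (radius k)\<^sup>2"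
proof (induction k)
  case 0
  then show ?case by (simp add: radius_def)
next
  case (Suc k)
  have "0 \<le> drift k * radius k" by (simp add: drift_nonneg radius_nonneg)
  then show ?case using Suc by (simp add: radius_Suc power2_eq_square algebra_simps)
qed

lemma d_ge_1: "1 \<le> d" unfolding d_def by (rule ge_one_powr_ge_zero) auto

lemma q_ge_1: "1 \<le> q"
proof -
  have "1 \<le> (1 / min 1 \<epsilon>) powr (1/8)" using \<epsilon> by (intro ge_one_powr_ge_zero) (auto simp: le_divide_eq)
  then show ?thesis using \<epsilon> by (simp add: q_def powr_divide powr_minus_divide)
qed

lemma d_power: "d ^ n = max D_\<Lambda> 1 powr (real n / 8)"
proof -
  have "d ^ n = d powr real n" by (rule powr_realpow[symmetric]) (simp add: d_def)
  then show ?thesis by (simp add: d_def powr_powr)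
qed

lemma q_power: "q ^ n = 1 / min 1 \<epsilon> powr (real n / 8)"
proof -
  have "q ^ n = q powr real n" by (rule powr_realpow[symmetric]) (use \<epsilon> in \<open>simp add: q_def\<close>)
  then show ?thesis by (simp add: q_def powr_powr flip: powr_minus_divide)
qed

lemma d_8: "d ^ 8 = max D_\<Lambda> 1" by (subst d_power) simp

lemma q_8: "q ^ 8 = 1 / min 1 \<epsilon>" using \<epsilon> by (subst q_power) simp

lemma inverse_\<epsilon>_le: "1 / \<epsilon> \<le> q ^ 8"
  using \<epsilon> by (simp add: q_8 frac_le)

lemma min_sqrt_\<epsilon>: "min 1 (sqrt \<epsilon>) = 1 / q ^ 4"
proof -
  have "1 / q ^ 4 = min 1 \<epsilon> powr (1/2)" by (subst q_power) simp
  also have "\<dots> = sqrt (min 1 \<epsilon>)" using \<epsilon> by (simp add: powr_half_sqrt)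
  also have "\<dots> = min 1 (sqrt \<epsilon>)" by (simp add: min_def)
  finally show ?thesis by simp
qed

lemma drift_le: "drift k \<le> sqrt (2 * \<rho>0) / q\<^sup>2 * (1 / sqrt (real k + 1))"
proof -
  have "(real k + 1) powr (3/2) * (real k + 1) powr (-5/2) = (real k + 1) powr (- 1)"
    by (simp flip: powr_add)
  then have e: "(real k + 1) powr (3/2) * (real k + 1) powr (-5/2) = 1 / (real k + 1)"
    by (simp add: powr_minus_divide)
  have "2 * \<rho> k * \<eta> k = 2 * \<rho>0 * \<eta>0 * ((real k + 1) powr (3/2) * (real k + 1) powr (-5/2)) / q ^ 4"
    unfolding \<rho> \<eta> min_sqrt_\<epsilon> by simp
  also have "\<dots> = \<eta>0 * (2 * \<rho>0 / q ^ 4 * (1 / (real k + 1)))" unfolding e by (simp add: mult_ac)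
  also have "\<dots> \<le> 1 * (2 * \<rho>0 / q ^ 4 * (1 / (real k + 1)))"
    using \<eta>0 \<rho>0 q_ge_1 by (intro mult_right_mono) auto
  finally have "drift k \<le> sqrt (2 * \<rho>0 / q ^ 4 * (1 / (real k + 1)))"
    unfolding drift_def by (intro real_sqrt_le_mono) simp
  also have "\<dots> = sqrt (2 * \<rho>0) / q\<^sup>2 * (1 / sqrt (real k + 1))"
  proof -
    have "sqrt (q ^ 4) = q\<^sup>2" using real_sqrt_abs[of "q\<^sup>2"] by simp
    then show ?thesis by (simp add: real_sqrt_mult real_sqrt_divide)
  qed
  finally show ?thesis .
qed

lemma sum_drift_le: "(\<Sum>i<k. drift i) \<le> 2 * sqrt (2 * \<rho>0) * sqrt (real k) / q\<^sup>2"
proof -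
  have "(\<Sum>i<k. drift i) \<le> (\<Sum>i<k. sqrt (2 * \<rho>0) / q\<^sup>2 * (1 / sqrt (real i + 1)))"
    by (intro sum_mono drift_le)
  also have "\<dots> = sqrt (2 * \<rho>0) / q\<^sup>2 * (\<Sum>i<k. 1 / sqrt (real i + 1))"
    by (simp only: sum_distrib_left)
  also have "\<dots> \<le> sqrt (2 * \<rho>0) / q\<^sup>2 * (2 * sqrt (real k))"
    using \<rho>0 by (intro mult_left_mono sum_inverse_sqrt_le) auto
  finally show ?thesis by (simp add: mult_ac)
qed

lemma sqrt_2_\<rho>0: "sqrt (2 * \<rho>0) \<le> 283/200 * \<rho>0"
proof (rule real_le_lsqrt)
  have "\<rho>0 * 1 \<le> \<rho>0\<^sup>2" unfolding power2_eq_square using \<rho>0 by (intro mult_left_mono) auto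
  moreover have "(283/200 * \<rho>0)\<^sup>2 = 80089/40000 * \<rho>0\<^sup>2" by (simp add: power_mult_distrib power_divide)
  ultimately show "2 * \<rho>0 \<le> (283/200 * \<rho>0)\<^sup>2" using zero_le_power2[of \<rho>0] by linarith
qed (use \<rho>0 in auto)

text \<open>If \<open>k\<close> exceeded the bound, the later half of the outer iterations would all be settled, and
  the lengths of their proximal point steps alone would exceed the budget \<open>2 (radius k)\<^sup>2\<close>: the sum of
  the \<open>\<rho>\<^sub>i\<^sup>2\<close> is of order \<open>k\<^sup>4\<close>, the radius only of order \<open>D\<^sub>\<Lambda>\<close> plus the square root of \<open>k\<close>.\<close>

lemma outer_count:
  assumes "outer_inv k \<mu>" shows "real k \<le> 12 * d ^ 4 * q ^ 4"
proof (rule ccontr)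
  define w where "w = d ^ 4 * q ^ 4"
  define n where "n = real k"
  assume "\<not> ?thesis"
  then have n: "12 * w < n" by (simp add: w_def n_def)
  have w1: "1 \<le> w" unfolding w_def using d_ge_1 q_ge_1
    by (metis mult_mono' one_le_power mult_1 zero_le_one)
  have q0: "0 < q" and d0: "0 < d" using q_ge_1 d_ge_1 by auto
  have wq: "q ^ 4 \<le> w" unfolding w_def using d_ge_1 q0 by (simp add: mult_le_cancel_right1)
  have settled: "settled i" and big: "\<rho>0\<^sup>2 * (n / 2) ^ 3 \<le> (\<rho> i)\<^sup>2" if "i \<in> {k div 2..<k}" for i
  proof -
    have i: "n / 2 \<le> real i + 1" using that unfolding n_def by simp linarith
    define c where "c = real i + 1"
    have c: "6 * q ^ 4 \<le> c" "0 < c" using i n wq by (auto simp: c_def)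
    have "(\<rho> i)\<^sup>2 = \<rho>0\<^sup>2 * c ^ 3"
      using c by (simp add: \<rho> c_def[symmetric] power_mult_distrib powr_power powr_realpow)
    moreover have "\<rho>0\<^sup>2 * (n / 2) ^ 3 \<le> \<rho>0\<^sup>2 * c ^ 3"
      using i by (intro mult_left_mono power_mono) (auto simp: c_def n_def)
    ultimately show "\<rho>0\<^sup>2 * (n / 2) ^ 3 \<le> (\<rho> i)\<^sup>2" by simp
    have "\<eta> i / \<rho> i = \<eta>0 / \<rho>0 * (c powr (-5/2) / c powr (3/2)) / q ^ 4"
      unfolding \<rho> \<eta> min_sqrt_\<epsilon> c_def by simp
    also have "c powr (-5/2) / c powr (3/2) = 1 / c ^ 4"
    proof -
      have "c powr (-5/2) / c powr (3/2) = c powr (-5/2 - 3/2)" by (rule powr_diff[symmetric])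
      also have "\<dots> = c powr (- 4)" by simp
      also have "\<dots> = 1 / c powr 4" by (rule powr_minus_divide)
      finally show ?thesis using c by simp
    qed
    also have "\<eta>0 / \<rho>0 * (1 / c ^ 4) / q ^ 4 \<le> 1 * (1 / c ^ 4) / q ^ 4"
      using \<eta>0 \<rho>0 c q0 by (intro divide_right_mono mult_right_mono) auto
    also have "\<dots> \<le> 1 * (1 / c ^ 4) / 1"
      using q_ge_1 c by (intro divide_left_mono) auto
    also have "\<dots> \<le> 1 / (6 * q ^ 4) ^ 4"
      using c q0 by (simp only: mult_1 div_by_1) (intro divide_left_mono power_mono mult_pos_pos zero_less_power, auto)
    also have "\<dots> \<le> (1 / q ^ 8)\<^sup>2 / 128"
      using q0 by (simp add: power_mult_distrib power_divide field_simps flip: power_mult)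
    also have "\<dots> \<le> \<epsilon>\<^sup>2 / 128"
      using \<epsilon> by (intro divide_right_mono power_mono) (auto simp: q_8)
    finally show "settled i" by (simp add: settled_def)
  qed
  have "(5 / 8 * \<epsilon> * \<rho>0 * (n / 2)\<^sup>2)\<^sup>2 = n / 2 * (25 / 64 * \<epsilon>\<^sup>2 * (\<rho>0\<^sup>2 * (n / 2) ^ 3))"
    by (simp add: power2_eq_square power3_eq_cube)
  also have "\<dots> \<le> real (card {k div 2..<k}) * (25 / 64 * \<epsilon>\<^sup>2 * (\<rho>0\<^sup>2 * (n / 2) ^ 3))"
    by (intro mult_right_mono) (auto simp: n_def)
  also have "\<dots> = (\<Sum>i\<in>{k div 2..<k}. 25 / 64 * \<epsilon>\<^sup>2 * (\<rho>0\<^sup>2 * (n / 2) ^ 3))" by simp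
  also have "\<dots> \<le> (\<Sum>i\<in>{k div 2..<k}. (5 / 8 * \<epsilon> * \<rho> i)\<^sup>2)"
  proof (rule sum_mono)
    fix i assume "i \<in> {k div 2..<k}"
    from mult_left_mono[OF big[OF this], of "25 / 64 * \<epsilon>\<^sup>2"]
    show "25 / 64 * \<epsilon>\<^sup>2 * (\<rho>0\<^sup>2 * (n / 2) ^ 3) \<le> (5 / 8 * \<epsilon> * \<rho> i)\<^sup>2"
      by (simp add: power_mult_distrib power_divide)
  qed
  also have "\<dots> \<le> (\<Sum>i\<in>{i. i < k \<and> settled i}. (5 / 8 * \<epsilon> * \<rho> i)\<^sup>2)"
    using settled by (intro sum_mono2) auto
  also have "\<dots> \<le> 2 * (radius k)\<^sup>2"
    using assms budget_le[of k] zero_le_power2[of "norm (\<mu> - lam_hat)"] unfolding outer_inv_def by linarith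
  also have "\<dots> \<le> (3 / 2 * radius k)\<^sup>2" by (simp add: power_mult_distrib power_divide)
  finally have "5 / 8 * \<epsilon> * \<rho>0 * (n / 2)\<^sup>2 \<le> 3 / 2 * radius k"
    by (rule power2_le_imp_le) (simp add: radius_nonneg)
  then have "\<rho>0 * n\<^sup>2 \<le> 48 / 5 * radius k * (1 / \<epsilon>)"
    using \<epsilon> by (simp add: field_simps power_divide)
  also have "\<dots> \<le> 48 / 5 * radius k * q ^ 8"
    using inverse_\<epsilon>_le by (intro mult_left_mono) (auto simp: radius_nonneg)
  also have "radius k \<le> \<rho>0 * (d ^ 8 + 283/100 * sqrt n / q\<^sup>2)"
  proof -
    have "D_\<Lambda> \<le> \<rho>0 * d ^ 8" using \<rho>0 d_ge_1 mult_right_mono[OF \<rho>0, of "d ^ 8"] by (simp add: d_8)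
    moreover have "2 * sqrt (2 * \<rho>0) \<le> 283/100 * \<rho>0" using sqrt_2_\<rho>0 by simp
    then have "2 * sqrt (2 * \<rho>0) * (sqrt n / q\<^sup>2) \<le> 283/100 * \<rho>0 * (sqrt n / q\<^sup>2)"
      by (intro mult_right_mono) (auto simp: n_def)
    ultimately show ?thesis
      using sum_drift_le[of k] unfolding radius_def n_def by (simp add: algebra_simps)
  qed
  finally have "\<rho>0 * n\<^sup>2 \<le> \<rho>0 * (48 / 5 * (d ^ 8 + 283/100 * sqrt n / q\<^sup>2) * q ^ 8)"
    using q0 by (simp add: mult_ac)
  then have "n\<^sup>2 \<le> 48 / 5 * (d ^ 8 + 283/100 * sqrt n / q\<^sup>2) * q ^ 8"
    using \<rho>0 by (simp add: mult_le_cancel_left)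
  also have "\<dots> = 48 / 5 * w\<^sup>2 + 48 / 5 * 283/100 * (sqrt n * q ^ 6)"
  proof -
    have "q ^ 8 = q\<^sup>2 * q ^ 6" by (simp flip: power_add)
    moreover have "w\<^sup>2 = d ^ 8 * q ^ 8" unfolding w_def by (simp add: power_mult_distrib flip: power_mult)
    ultimately show ?thesis using q0 by (simp add: field_simps)
  qed
  also have "w\<^sup>2 \<le> n * w / 12" using n w1 by (simp add: power2_eq_square)
  also have "sqrt n * q ^ 6 \<le> n * w / (17/5)"
  proof -
    have "17/5 * q\<^sup>2 \<le> sqrt n"
    proof (rule real_le_rsqrt)
      have "(17/5 * q\<^sup>2)\<^sup>2 \<le> 12 * q ^ 4" by (simp add: power_mult_distrib power_divide flip: power_mult)
      also have "\<dots> \<le> n" using wq n by linarith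
      finally show "(17/5 * q\<^sup>2)\<^sup>2 \<le> n" .
    qed
    then have "sqrt n * (17/5 * q\<^sup>2) * q ^ 4 \<le> sqrt n * sqrt n * w"
      using wq q0 n w1 by (intro mult_mono) auto
    also have "sqrt n * sqrt n = n" by (simp add: n_def)
    also have "sqrt n * (17/5 * q\<^sup>2) * q ^ 4 = 17/5 * (sqrt n * q ^ 6)" by (simp flip: power_add)
    finally show ?thesis by simp
  qed
  finally have "n * n \<le> 48 / 5 * (n * w / 12) + 48 / 5 * (283 / 100) * (n * w / (17/5))"
    by (simp add: power2_eq_square)
  moreover have "0 \<le> n * w" using n w1 by simp
  ultimately have "n * n \<le> n * (9 * w)" by simp
  then show False using n w1 by (simp add: mult_le_cancel_left)
qed

section \<open>Total iteration count\<close>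

text \<open>Upper bounds, in the outer index only, for the Lipschitz constant of the inner problems and
  for the lengths of the inner runs.\<close>

definition "lip_bound k = B + L_dg * (\<Sum>i<k. drift i) + \<rho> k * C"
definition "main_bound k = 1 + D_X * sqrt (2 * lip_bound k / \<eta> k)"
definition "post_bound k = 1 + D_X * (8 + 12 * lip_bound k) / \<epsilon>"

lemma lip_le_bound:
  assumes "outer_inv k \<mu>" shows "lip \<mu> (\<rho> k) \<le> lip_bound k"
proof -
  have "norm \<mu> \<le> norm lam_hat + radius k"
    using assms norm_triangle_ineq[of "\<mu> - lam_hat" lam_hat] by (simp add: outer_inv_def)
  then have "L_dg * norm \<mu> \<le> L_dg * (norm lam_hat + radius k)"
    using constants_nonneg by (intro mult_left_mono) auto
  then show ?thesis
    unfolding lip_bound_def smooth_lip_def radius_def unfolding B C by (simp add: algebra_simps)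
qed

lemma B_nonneg: "0 \<le> B" and C_nonneg: "0 \<le> C"
  using constants_nonneg D_\<Lambda>_nonneg by (simp_all add: B C)

lemma lip_bound_nonneg: "0 \<le> lip_bound k"
  unfolding lip_bound_def using B_nonneg C_nonneg constants_nonneg \<rho>_pos[of k]
  by (intro add_nonneg_nonneg mult_nonneg_nonneg sum_nonneg drift_nonneg) auto

lemma main_bound_ge_1: "1 \<le> main_bound k"
  using lip_bound_nonneg[of k] \<eta>_pos[of k] constants_nonneg by (simp add: main_bound_def)

lemma post_bound_ge_1: "1 \<le> post_bound k"
  using lip_bound_nonneg[of k] \<epsilon> constants_nonneg by (simp add: post_bound_def)

text \<open>The two branches of the accuracy lead to square roots of \<open>256 L / \<rho>\<^sub>k\<close> and of \<open>16 L\<^sup>2\<close>, up to the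
  factor \<open>1 / \<epsilon>\<close>; since \<open>\<rho>\<^sub>k \<ge> 1\<close>, both are at most \<open>8 + 12 L\<close>.\<close>

lemma post_count:
  assumes outer: "outer_inv k \<mu>" and inv: "inner_inv \<mu> (\<rho> k) j x z"
    and far: "post_accuracy L_f L_dg L_g M_g \<epsilon> \<mu> (\<rho> k)
      < auglag \<mu> (\<rho> k) x - auglag \<mu> (\<rho> k) (auglag_min \<mu> (\<rho> k))"
  shows "real (Suc j) \<le> post_bound k"
proof -
  define L where "L = lip \<mu> (\<rho> k)"
  define e where "e = post_accuracy L_f L_dg L_g M_g \<epsilon> \<mu> (\<rho> k)"
  have r: "0 < \<rho> k" by (rule \<rho>_pos)
  have L0: "0 \<le> L" unfolding L_def by (rule lip_nonneg[OF r])
  have e: "e = \<epsilon>\<^sup>2 * min (\<rho> k / 128) (1 / (8 * L))" by (simp add: e_def post_accuracy_def L_def)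
  show ?thesis
  proof (cases "L = 0")
    case True
    have "j = 0" by (rule inner_inv_exact[OF r inv]) (use True far e r in \<open>auto simp: L_def e_def\<close>)
    then show ?thesis using post_bound_ge_1[of k] by simp
  next
    case False
    then have L: "0 < L" using L0 by simp
    have e0: "0 < e" using L r \<epsilon> by (simp add: e)
    have "real (Suc j) \<le> 1 + D_X * sqrt (2 * L / e)"
      by (rule inner_inv_count[OF r inv _ e0]) (use far in \<open>simp_all add: L_def e_def\<close>)
    also have "sqrt (2 * L / e) \<le> (8 + 12 * L) / \<epsilon>"
    proof (rule real_le_lsqrt)
      have \<rho>1: "1 \<le> \<rho> k" unfolding \<rho> using \<rho>0 ge_one_powr_ge_zero[of "real k + 1" "3/2"]
        mult_mono[of 1 \<rho>0 1 "(real k + 1) powr (3/2)"] by simp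
      have "2 * L \<le> (8 + 12 * L)\<^sup>2 * (\<rho> k / 128)"
      proof -
        have "2 * L \<le> (8 + 12 * L)\<^sup>2 * (1 / 128)"
        proof -
          have "(8 + 12 * L)\<^sup>2 * (1 / 128) = 1 / 2 + 3 / 2 * L + 9 / 8 * L\<^sup>2"
            by (simp add: power2_eq_square algebra_simps)
          moreover have "(L - 1 / 4)\<^sup>2 = L\<^sup>2 - L / 2 + 1 / 16" by (simp add: power2_eq_square algebra_simps)
          ultimately show ?thesis
            using zero_le_power2[of "L - 1 / 4"] zero_le_power2[of L] by linarith
        qed
        also have "\<dots> \<le> (8 + 12 * L)\<^sup>2 * (\<rho> k / 128)" using \<rho>1 by (intro mult_left_mono) auto
        finally show ?thesis .
      qed
      moreover have "2 * L \<le> (8 + 12 * L)\<^sup>2 * (1 / (8 * L))"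
        using L by (simp add: power2_eq_square field_simps)
      ultimately have "2 * L \<le> (8 + 12 * L)\<^sup>2 * min (\<rho> k / 128) (1 / (8 * L))" by (simp add: min_def)
      then have "2 * L * \<epsilon>\<^sup>2 \<le> (8 + 12 * L)\<^sup>2 * min (\<rho> k / 128) (1 / (8 * L)) * \<epsilon>\<^sup>2"
        by (rule mult_right_mono) simp
      then have "2 * L * \<epsilon>\<^sup>2 \<le> (8 + 12 * L)\<^sup>2 * e" by (simp add: e mult_ac)
      then show "2 * L / e \<le> ((8 + 12 * L) / \<epsilon>)\<^sup>2"
        using e0 \<epsilon> by (simp add: power_divide pos_divide_le_eq pos_le_divide_eq mult_ac)
    qed (use L e0 \<epsilon> in auto)
    also have "(8 + 12 * L) / \<epsilon> \<le> (8 + 12 * lip_bound k) / \<epsilon>"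
      using lip_le_bound[OF outer] \<epsilon> by (intro divide_right_mono) (auto simp: L_def)
    finally show ?thesis using constants_nonneg by (simp add: post_bound_def mult_left_mono)
  qed
qed

lemma complexity_T_eq:
  "complexity_T D_X (max D_\<Lambda> 1) (max B 1) (max C 1) L_dg (min 1 \<epsilon>) =
     D_X * d ^ 12 * max C 1 * q ^ 14
   + D_X * d ^ 10 * sqrt (max B 1) * (1 + sqrt L_dg) * q ^ 11
   + D_X * d\<^sup>2 * (L_dg + sqrt L_dg) * q ^ 9
   + D_X * max B 1 * q ^ 8 + d ^ 4 * q ^ 4"
  unfolding complexity_T_def d_power q_power using constants_nonneg \<epsilon>
  by (simp add: powr_half_sqrt)

text \<open>An inner run of outer iteration \<open>i\<close> has length of order \<open>D\<^sub>X\<close> times the square root of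
  \<open>L\<^sub>i / \<eta>\<^sub>i\<close>. Summed over \<open>O(d\<^sup>4 q\<^sup>4)\<close> outer iterations, the part \<open>\<rho>\<^sub>i C\<close> of
  \<open>L\<^sub>i\<close> yields the first term of the complexity, the remaining parts of \<open>L\<^sub>i\<close> yield the second
  one, and the additive constants the last one; the third and fourth terms arise from postprocessing.\<close>

lemma total_count:
  assumes outer: "outer_inv k \<mu>"
  shows "(\<Sum>i\<le>k. main_bound i) + post_bound k
    \<le> hidden_constant \<rho>0 \<eta>0 * complexity_T D_X (max D_\<Lambda> 1) (max B 1) (max C 1) L_dg (min 1 \<epsilon>)"
proof -
  define b c l where "b = max B 1" and "c = max C 1" and "l = L_dg"
  (* m ^ 4 = 16 d\<^sup>4 q\<^sup>4 leaves room for the outer iteration with index 12 d\<^sup>4 q\<^sup>4. *)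
  define m where "m = 2 * d * q"
  define \<kappa> where "\<kappa> = \<rho>0 / \<eta>0"
  have d1: "1 \<le> d" and q1: "1 \<le> q" by (rule d_ge_1, rule q_ge_1)
  have b1: "1 \<le> b" "1 \<le> sqrt b" and c1: "1 \<le> c" and l0: "0 \<le> l" "0 \<le> sqrt l"
    using constants_nonneg by (auto simp: b_def c_def l_def)
  have m1: "1 \<le> m" unfolding m_def using mult_mono[OF d1 q1] d1 by simp
  have \<kappa>: "1 \<le> \<kappa>" "\<rho>0 \<le> \<kappa>" using \<rho>0 \<eta>0 by (auto simp: \<kappa>_def le_divide_eq mult_le_cancel_left1)
  have DX: "0 \<le> D_X" using constants_nonneg by simp
  have dq: "1 \<le> d ^ 4 * q ^ 4"
    using mult_mono[of 1 "d ^ 4" 1 "q ^ 4"] d1 q1 by (simp add: one_le_power)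
  have k: "real k + 1 \<le> m ^ 4"
    using outer_count[OF outer] dq by (simp add: m_def power_mult_distrib)
  have drift: "(\<Sum>i<i'. drift i) \<le> 10 * \<rho>0 * d\<^sup>2" if "i' \<le> k" for i'
  proof -
    have "sqrt (real i') \<le> 7/2 * (d\<^sup>2 * q\<^sup>2)"
    proof (rule real_le_lsqrt)
      have "real i' \<le> 12 * (d ^ 4 * q ^ 4)" using outer_count[OF outer] that by simp
      also have "\<dots> \<le> (7/2 * (d\<^sup>2 * q\<^sup>2))\<^sup>2"
        using dq by (simp add: power_mult_distrib power_divide flip: power_mult)
      finally show "real i' \<le> (7/2 * (d\<^sup>2 * q\<^sup>2))\<^sup>2" .
    qed auto
    then have "2 * sqrt (2 * \<rho>0) * sqrt (real i') \<le> 2 * (283/200 * \<rho>0) * (7/2 * (d\<^sup>2 * q\<^sup>2))"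
      using \<rho>0 sqrt_2_\<rho>0 by (intro mult_mono) auto
    also have "\<dots> \<le> 10 * \<rho>0 * d\<^sup>2 * q\<^sup>2" using \<rho>0 by (simp add: mult_ac)
    finally have "2 * sqrt (2 * \<rho>0) * sqrt (real i') / q\<^sup>2 \<le> 10 * \<rho>0 * d\<^sup>2"
      using q1 by (simp add: pos_divide_le_eq)
    then show ?thesis using sum_drift_le[of i'] by linarith
  qed
  have lb: "lip_bound i \<le> b + 10 * \<rho>0 * d\<^sup>2 * l + \<rho>0 * m ^ 6 * c" if "i \<le> k" for i
  proof -
    have "(real i + 1) powr (3/2) \<le> (m ^ 4) powr (3/2)" using k that by (intro powr_mono2) auto
    also have "\<dots> = m ^ 6" using m1 by (intro power_powr_eq) auto
    finally have "\<rho> i * C \<le> \<rho>0 * m ^ 6 * c"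
      unfolding \<rho> using \<rho>0 C_nonneg m1 by (intro mult_mono) (auto simp: c_def)
    moreover have "L_dg * (\<Sum>i<i. drift i) \<le> l * (10 * \<rho>0 * d\<^sup>2)"
      using drift[OF that] l0 unfolding l_def by (intro mult_left_mono)
    moreover have "B \<le> b" by (simp add: b_def)
    ultimately show ?thesis unfolding lip_bound_def by (simp add: mult_ac)
  qed
  define s where "s = sqrt b + 4 * \<rho>0 * d * sqrt l + \<rho>0 * m ^ 3 * c"
  have sqrt_lb: "sqrt (lip_bound i) \<le> s" if "i \<le> k" for i
  proof -
    have "sqrt (lip_bound i) \<le> sqrt (b + 10 * \<rho>0 * d\<^sup>2 * l + \<rho>0 * m ^ 6 * c)"
      using lb[OF that] by (rule real_sqrt_le_mono)
    also have "\<dots> \<le> sqrt (b + 10 * \<rho>0 * d\<^sup>2 * l) + sqrt (\<rho>0 * m ^ 6 * c)"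
      using b1 \<rho>0 l0 m1 c1 by (intro sqrt_add_le_add_sqrt) auto
    also have "sqrt (b + 10 * \<rho>0 * d\<^sup>2 * l) \<le> sqrt b + sqrt (10 * \<rho>0 * d\<^sup>2 * l)"
      using b1 \<rho>0 l0 by (intro sqrt_add_le_add_sqrt) auto
    also have "sqrt (10 * \<rho>0 * d\<^sup>2 * l) \<le> 4 * \<rho>0 * d * sqrt l"
    proof (rule real_le_lsqrt)
      have "10 * \<rho>0 * (d\<^sup>2 * l) \<le> 16 * (\<rho>0 * \<rho>0) * (d\<^sup>2 * l)"
        using \<rho>0 l0 mult_left_mono[OF \<rho>0, of \<rho>0] by (intro mult_right_mono) auto
      then show "10 * \<rho>0 * d\<^sup>2 * l \<le> (4 * \<rho>0 * d * sqrt l)\<^sup>2"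
        unfolding power_mult_distrib real_sqrt_pow2[OF l0(1)] power2_eq_square[of \<rho>0] by (simp add: mult_ac)
    qed (use \<rho>0 l0 d1 in auto)
    also have "sqrt (\<rho>0 * m ^ 6 * c) \<le> \<rho>0 * m ^ 3 * c"
    proof (rule real_le_lsqrt)
      have "\<rho>0 * m ^ 6 * c \<le> (\<rho>0 * \<rho>0) * m ^ 6 * (c * c)"
        using \<rho>0 c1 m1 mult_left_mono[OF \<rho>0, of \<rho>0] mult_left_mono[OF c1(1), of c] by (intro mult_mono) auto
      then show "\<rho>0 * m ^ 6 * c \<le> (\<rho>0 * m ^ 3 * c)\<^sup>2"
        by (simp add: power_mult_distrib power2_eq_square mult_ac flip: power_add)
    qed (use \<rho>0 c1 m1 in auto)
    finally show ?thesis by (simp add: s_def)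
  qed
  have s0: "0 \<le> s" using sqrt_lb[of 0] lip_bound_nonneg[of 0] real_sqrt_ge_zero order_trans by blast
  have main: "main_bound i \<le> 1 + D_X * (3 / 2 / \<eta>0 * m ^ 5 * q\<^sup>2 * s)" if "i \<le> k" for i
  proof -
    have "1 / \<eta> i = (real i + 1) powr (5/2) * q ^ 4 / \<eta>0"
      unfolding \<eta> min_sqrt_\<epsilon> using \<eta>0 by (simp add: powr_minus_divide field_simps)
    also have "(real i + 1) powr (5/2) \<le> (m ^ 4) powr (5/2)" using k that by (intro powr_mono2) auto
    also have "(m ^ 4) powr (5/2) = m ^ 10" using m1 by (intro power_powr_eq) auto
    finally have "1 / \<eta> i \<le> m ^ 10 * q ^ 4 / \<eta>0" using \<eta>0 by (simp add: divide_right_mono mult_right_mono)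
    also have "\<dots> \<le> m ^ 10 * q ^ 4 / (\<eta>0 * \<eta>0)"
      using \<eta>0 m1 q1 mult_left_mono[OF \<eta>0(2), of \<eta>0] by (intro divide_left_mono) auto
    finally have \<eta>i: "1 / \<eta> i \<le> m ^ 10 * q ^ 4 / (\<eta>0 * \<eta>0)" .
    have "lip_bound i \<le> s\<^sup>2" using sqrt_lb[OF that] by (rule sqrt_le_D)
    then have "2 * lip_bound i * (1 / \<eta> i) \<le> 2 * s\<^sup>2 * (m ^ 10 * q ^ 4 / (\<eta>0 * \<eta>0))"
      using \<eta>i \<eta>_pos[of i] lip_bound_nonneg[of i] by (intro mult_mono) auto
    also have "\<dots> = 2 * (1 / \<eta>0 * m ^ 5 * q\<^sup>2 * s)\<^sup>2"
    proof -
      have "m ^ 10 * q ^ 4 = (m ^ 5 * q\<^sup>2)\<^sup>2" by algebra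
      then show ?thesis by (simp add: power_divide power2_eq_square mult_ac)
    qed
    also have "\<dots> \<le> (3 / 2 * (1 / \<eta>0 * m ^ 5 * q\<^sup>2 * s))\<^sup>2"
      unfolding power_mult_distrib[of "3 / 2"] by (intro mult_right_mono) (auto simp: power_divide)
    also have "3 / 2 * (1 / \<eta>0 * m ^ 5 * q\<^sup>2 * s) = 3 / 2 / \<eta>0 * m ^ 5 * q\<^sup>2 * s" by simp
    finally have "sqrt (2 * lip_bound i / \<eta> i) \<le> 3 / 2 / \<eta>0 * m ^ 5 * q\<^sup>2 * s"
      using \<eta>0 m1 s0 by (intro real_le_lsqrt) auto
    from mult_left_mono[OF this DX] show ?thesis unfolding main_bound_def by (rule add_left_mono)
  qed
  have t0: "0 \<le> 1 + D_X * (3 / 2 / \<eta>0 * m ^ 5 * q\<^sup>2 * s)"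
    using DX \<eta>0 m1 s0 by (intro add_nonneg_nonneg mult_nonneg_nonneg) auto
  have "(\<Sum>i\<le>k. main_bound i) \<le> (\<Sum>i\<le>k. 1 + D_X * (3 / 2 / \<eta>0 * m ^ 5 * q\<^sup>2 * s))"
    by (intro sum_mono main) simp
  also have "\<dots> = (real k + 1) * (1 + D_X * (3 / 2 / \<eta>0 * m ^ 5 * q\<^sup>2 * s))" by (simp add: add.commute)
  also have "\<dots> \<le> m ^ 4 * (1 + D_X * (3 / 2 / \<eta>0 * m ^ 5 * q\<^sup>2 * s))"
    using k t0 by (rule mult_right_mono)
  also have "\<dots> = 16 * (d ^ 4 * q ^ 4) + 768 / \<eta>0 * (D_X * d ^ 9 * q ^ 11 * (sqrt b + 4 * \<rho>0 * d * sqrt l))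
      + 6144 * \<kappa> * (D_X * d ^ 12 * c * q ^ 14)"
  proof -
    have m4: "m ^ 4 = 16 * (d ^ 4 * q ^ 4)" and m9: "m ^ 4 * m ^ 5 * q\<^sup>2 = 512 * (d ^ 9 * q ^ 11)"
      and m12: "m ^ 4 * m ^ 5 * m ^ 3 * q\<^sup>2 = 4096 * (d ^ 12 * q ^ 14)"
      unfolding m_def by algebra+
    have split: "m ^ 4 * (1 + D_X * (3 / 2 / \<eta>0 * m ^ 5 * q\<^sup>2 * s)) = m ^ 4
        + 3 / 2 / \<eta>0 * (D_X * ((m ^ 4 * m ^ 5 * q\<^sup>2) * (sqrt b + 4 * \<rho>0 * d * sqrt l)))
        + 3 / 2 * \<kappa> * (D_X * ((m ^ 4 * m ^ 5 * m ^ 3 * q\<^sup>2) * c))"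
    proof -
      have "v * (1 + D_X * (3 / 2 * h * w * y * (u + \<rho>0 * e * c))) = v + 3 / 2 * h * (D_X * ((v * w * y) * u))
          + 3 / 2 * (\<rho>0 * h) * (D_X * ((v * w * e * y) * c))" for v w y u e h :: real
        by (simp add: algebra_simps)
      from this[of "m ^ 4" "1 / \<eta>0" "m ^ 5" "q\<^sup>2" _ "m ^ 3"] show ?thesis unfolding s_def \<kappa>_def by simp
    qed
    have e9: "3 / 2 / \<eta>0 * (D_X * (512 * (d ^ 9 * q ^ 11) * u)) = 768 / \<eta>0 * (D_X * d ^ 9 * q ^ 11 * u)" for u
      using \<eta>0 by (simp add: field_simps)
    have e12: "3 / 2 * \<kappa> * (D_X * (4096 * (d ^ 12 * q ^ 14) * c)) = 6144 * \<kappa> * (D_X * d ^ 12 * c * q ^ 14)"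
      by simp
    show ?thesis using split unfolding m9 m12 e9 e12 unfolding m4 .
  qed
  also have "768 / \<eta>0 * (D_X * d ^ 9 * q ^ 11 * (sqrt b + 4 * \<rho>0 * d * sqrt l))
      \<le> 768 / \<eta>0 * (D_X * d ^ 9 * q ^ 11 * (4 * \<rho>0 * d * (sqrt b * (1 + sqrt l))))"
  proof (intro mult_left_mono)
    have r: "1 \<le> \<rho>0 * d" using mult_mono[OF \<rho>0 d1] \<rho>0 by simp
    have "sqrt b \<le> 4 * \<rho>0 * d * sqrt b" using r b1 by (simp add: mult_le_cancel_right1)
    moreover have "4 * \<rho>0 * d * sqrt l * 1 \<le> 4 * \<rho>0 * d * sqrt l * sqrt b"
      using r l0 b1 \<rho>0 d1 by (intro mult_left_mono) auto
    ultimately show "sqrt b + 4 * \<rho>0 * d * sqrt l \<le> 4 * \<rho>0 * d * (sqrt b * (1 + sqrt l))"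
      by (simp add: algebra_simps)
  qed (use DX d1 q1 \<eta>0 in auto)
  also have "\<dots> = 3072 * \<kappa> * (D_X * d ^ 10 * sqrt b * (1 + sqrt l) * q ^ 11)"
    unfolding \<kappa>_def by (simp add: eval_nat_numeral field_simps)
  finally have sum: "(\<Sum>i\<le>k. main_bound i) \<le> 16 * (d ^ 4 * q ^ 4)
      + 3072 * \<kappa> * (D_X * d ^ 10 * sqrt b * (1 + sqrt l) * q ^ 11) + 6144 * \<kappa> * (D_X * d ^ 12 * c * q ^ 14)"
    by simp
  have "D_X * (8 + 12 * lip_bound k) * (1 / \<epsilon>)
      \<le> D_X * (20 * b + 12 * (10 * \<rho>0 * d\<^sup>2 * l + \<rho>0 * m ^ 6 * c)) * q ^ 8"
    using lb[of k] b1 DX lip_bound_nonneg[of k] inverse_\<epsilon>_le \<epsilon> by (intro mult_mono mult_left_mono) auto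
  also have "\<dots> = 20 * (D_X * b * q ^ 8) + 120 * \<rho>0 * (D_X * d\<^sup>2 * l * q ^ 8)
      + 768 * \<rho>0 * (D_X * d ^ 6 * c * q ^ 14)"
  proof -
    have "m ^ 6 * q ^ 8 = 64 * (d ^ 6 * q ^ 14)" unfolding m_def by algebra
    then have "D_X * (12 * (\<rho>0 * m ^ 6 * c)) * q ^ 8 = 768 * \<rho>0 * (D_X * d ^ 6 * c * q ^ 14)"
      by (simp add: mult_ac)
    then show ?thesis by (simp add: algebra_simps)
  qed
  also have "D_X * d\<^sup>2 * l * q ^ 8 \<le> D_X * d\<^sup>2 * (l + sqrt l) * q ^ 9"
    using DX l0 q1 d1 by (intro mult_mono power_increasing) auto
  also have "D_X * d ^ 6 * c * q ^ 14 \<le> D_X * d ^ 12 * c * q ^ 14"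
    using DX d1 c1 q1 by (intro mult_right_mono mult_left_mono power_increasing) auto
  finally have post: "post_bound k \<le> d ^ 4 * q ^ 4 + 20 * (D_X * b * q ^ 8)
      + 120 * \<rho>0 * (D_X * d\<^sup>2 * (l + sqrt l) * q ^ 9) + 768 * \<rho>0 * (D_X * d ^ 12 * c * q ^ 14)"
    using dq \<rho>0 by (simp add: post_bound_def)
  define t1 t2 t3 t4 t5 where t: "t1 = D_X * d ^ 12 * c * q ^ 14"
    "t2 = D_X * d ^ 10 * sqrt b * (1 + sqrt l) * q ^ 11" "t3 = D_X * d\<^sup>2 * (l + sqrt l) * q ^ 9"
    "t4 = D_X * b * q ^ 8" "t5 = d ^ 4 * q ^ 4"
  have tn: "0 \<le> t1" "0 \<le> t2" "0 \<le> t3" "0 \<le> t4" "0 \<le> t5"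
    unfolding t using DX d1 q1 b1 c1 l0 by auto
  have le: "a * t \<le> 10 ^ 4 * \<kappa> * t" if "a \<le> 10 ^ 4 * \<kappa>" "0 \<le> t" for a t :: real
    using that by (rule mult_right_mono)
  have "(\<Sum>i\<le>k. main_bound i) + post_bound k \<le> (6144 * \<kappa> + 768 * \<rho>0) * t1 + 3072 * \<kappa> * t2
      + 120 * \<rho>0 * t3 + 20 * t4 + 17 * t5"
    using sum post unfolding t[symmetric] by (simp add: algebra_simps)
  also have "\<dots> \<le> 10 ^ 4 * \<kappa> * t1 + 10 ^ 4 * \<kappa> * t2 + 10 ^ 4 * \<kappa> * t3 + 10 ^ 4 * \<kappa> * t4 + 10 ^ 4 * \<kappa> * t5"
    using \<kappa> tn by (intro add_mono le) auto
  also have "\<dots> = 10 ^ 4 * \<kappa> * (t1 + t2 + t3 + t4 + t5)" by (simp add: algebra_simps)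
  also have "\<dots> \<le> hidden_constant \<rho>0 \<eta>0 * (t1 + t2 + t3 + t4 + t5)"
  proof (rule mult_right_mono)
    have "10 ^ 4 * \<kappa> * 1 \<le> 10 ^ 9 * \<kappa> * \<rho>0" using \<kappa> \<rho>0 by (intro mult_mono) auto
    then show "10 ^ 4 * \<kappa> \<le> hidden_constant \<rho>0 \<eta>0"
      by (simp add: hidden_constant_def \<kappa>_def power2_eq_square)
  qed (use tn in auto)
  finally show ?thesis
    unfolding complexity_T_eq t b_def c_def l_def .
qed

section \<open>Invariant of the execution\<close>

abbreviation "step \<equiv> alm_step f P g K L_f L_dg L_g M_g \<epsilon> \<rho> \<eta>"

abbreviation "total_bound \<equiv>
  hidden_constant \<rho>0 \<eta>0 * complexity_T D_X (max D_\<Lambda> 1) (max B 1) (max C 1) L_dg (min 1 \<epsilon>)"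

text \<open>The first argument is the number of transitions so far. Before the output, each of them either is
  an inner iteration or increases the outer index, except for the one that enters postprocessing; hence
  the two counters determine this number, and bounds for them imply termination.\<close>

fun run_inv :: "nat \<Rightarrow> nat \<times> ('a, 'b) alm_state \<Rightarrow> bool" where
  "run_inv i (N, Main k \<mu> j x z) \<longleftrightarrow> i = N + k \<and> outer_inv k \<mu> \<and> inner_inv \<mu> (\<rho> k) j x z \<and>
     real N \<le> (\<Sum>l<k. main_bound l) + real j \<and> real j \<le> main_bound k"
| "run_inv i (N, Post \<mu> r j x z) \<longleftrightarrow> (\<exists>k. i = Suc (N + k) \<and> r = \<rho> k \<and> outer_inv k \<mu> \<and>
     inner_inv \<mu> r j x z \<and> real N \<le> (\<Sum>l\<le>k. main_bound l) + real j \<and> real j \<le> post_bound k \<and>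
     (\<exists>x1\<in>X. auglag \<mu> r x1 - auglag \<mu> r (auglag_min \<mu> r) \<le> \<eta> k \<and>
        small_step \<epsilon> \<rho> \<eta> k \<mu> (proj (\<mu> + r *\<^sub>R g x1))))"
| "run_inv i (N, Output x \<mu>) \<longleftrightarrow> eps_kkt f P g K \<epsilon> x \<mu> \<and> real N \<le> total_bound"

lemma run_inv_Main_count:
  assumes "run_inv i (N, Main k \<mu> j x z)" shows "real N \<le> (\<Sum>l\<le>k. main_bound l)" "real N \<le> total_bound"
proof -
  show le: "real N \<le> (\<Sum>l\<le>k. main_bound l)"
    using assms by (simp add: lessThan_Suc_atMost[symmetric])
  show "real N \<le> total_bound"
    using assms le total_count[of k \<mu>] post_bound_ge_1[of k] by simp
qed

lemma run_inv_Post_count: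
  assumes "run_inv i (N, Post \<mu> r j x z)" shows "real N \<le> total_bound"
  using assms total_count by fastforce

lemma run_inv_step:
  assumes step: "step c c'" and inv: "run_inv i c"
  shows "run_inv (Suc i) c'"
  using step
proof cases
  case (main_inner \<mu> k x j z x' z' N)
  have inn: "inner_inv \<mu> (\<rho> k) j x z" and out: "outer_inv k \<mu>" using inv main_inner by auto
  then have x: "x \<in> X" by (simp add: inner_inv_def)
  have "\<eta> k < auglag \<mu> (\<rho> k) x - auglag \<mu> (\<rho> k) (auglag_min \<mu> (\<rho> k))"
    using main_inner(3) by (simp add: near_min_iff[OF \<rho>_pos x])
  from inner_inv_count[OF \<rho>_pos inn lip_le_bound[OF out] \<eta>_pos this]
  have "real (Suc j) \<le> main_bound k" by (simp add: main_bound_def)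
  then show ?thesis using inv main_inner inner_inv_step[OF \<rho>_pos inn main_inner(4)] by simp
next
  case (main_output \<mu> k x \<mu>' N j z)
  have "real N \<le> total_bound" using inv unfolding main_output(1) by (rule run_inv_Main_count(2))
  then show ?thesis using main_output by simp
next
  case (main_post \<mu> k x \<mu>' N j z)
  have inn: "inner_inv \<mu> (\<rho> k) j x z" using inv main_post by auto
  then have x: "x \<in> X" by (simp add: inner_inv_def)
  have "\<exists>x1\<in>X. auglag \<mu> (\<rho> k) x1 - auglag \<mu> (\<rho> k) (auglag_min \<mu> (\<rho> k)) \<le> \<eta> k \<and>
        small_step \<epsilon> \<rho> \<eta> k \<mu> (proj (\<mu> + \<rho> k *\<^sub>R g x1))"
    using main_post x by (intro bexI[of _ x]) (auto simp: near_min_iff[OF \<rho>_pos x] multiplier_update_def)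
  moreover have "real N \<le> (\<Sum>l\<le>k. main_bound l)" using inv unfolding main_post(1) by (rule run_inv_Main_count(1))
  moreover have "0 \<le> post_bound k" using post_bound_ge_1[of k] by simp
  ultimately show ?thesis using inv main_post inner_inv_start[OF x] by auto
next
  case (main_next \<mu> k x \<mu>' s N j z)
  have inn: "inner_inv \<mu> (\<rho> k) j x z" and out: "outer_inv k \<mu>" using inv main_next by auto
  then have x: "x \<in> X" by (simp add: inner_inv_def)
  have "outer_inv (Suc k) \<mu>'"
    using main_next outer_inv_step[OF out x] by (simp add: near_min_iff[OF \<rho>_pos x] multiplier_update_def)
  moreover have "real N \<le> (\<Sum>l\<le>k. main_bound l)" using inv unfolding main_next(1) by (rule run_inv_Main_count(1))
  moreover have "0 \<le> main_bound (Suc k)" using main_bound_ge_1[of "Suc k"] by simp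
  ultimately show ?thesis
    using inv main_next inner_inv_start[OF main_next(7)] by (simp add: lessThan_Suc_atMost[symmetric])
next
  case (post_inner \<mu> r x j z x' z' N)
  from inv post_inner obtain k where k: "i = Suc (N + k)" "r = \<rho> k" "outer_inv k \<mu>"
    "inner_inv \<mu> (\<rho> k) j x z" "real N \<le> (\<Sum>l\<le>k. main_bound l) + real j"
    "\<exists>x1\<in>X. auglag \<mu> r x1 - auglag \<mu> r (auglag_min \<mu> r) \<le> \<eta> k \<and>
        small_step \<epsilon> \<rho> \<eta> k \<mu> (proj (\<mu> + r *\<^sub>R g x1))" by auto
  have x: "x \<in> X" using k by (simp add: inner_inv_def)
  have "post_accuracy L_f L_dg L_g M_g \<epsilon> \<mu> (\<rho> k) < auglag \<mu> (\<rho> k) x - auglag \<mu> (\<rho> k) (auglag_min \<mu> (\<rho> k))"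
    using post_inner(3) by (simp add: near_min_iff[OF \<rho>_pos x] k)
  from post_count[OF k(3,4) this] have "real (Suc j) \<le> post_bound k" .
  moreover have "inner_inv \<mu> r (Suc j) x' z'"
    using inner_inv_step[OF \<rho>_pos k(4)] post_inner(4) k(2) by simp
  ultimately show ?thesis using post_inner k by (auto intro!: exI[of _ k])
next
  case (post_output \<mu> r x x' \<mu>' N j z)
  from inv post_output obtain k x1 where k: "r = \<rho> k" "inner_inv \<mu> (\<rho> k) j x z" "x1 \<in> X"
    "auglag \<mu> r x1 - auglag \<mu> r (auglag_min \<mu> r) \<le> \<eta> k"
    "small_step \<epsilon> \<rho> \<eta> k \<mu> (proj (\<mu> + r *\<^sub>R g x1))" by auto
  have x: "x \<in> X" using k by (simp add: inner_inv_def)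
  have r: "0 < r" using k \<rho>_pos by simp
  have "auglag \<mu> r x - auglag \<mu> r (auglag_min \<mu> r) \<le> post_accuracy L_f L_dg L_g M_g \<epsilon> \<mu> r"
    using post_output(3) by (simp only: near_min_iff[OF r x])
  then have "eps_kkt f P g K \<epsilon> x' (proj (\<mu> + r *\<^sub>R g x'))"
    by (rule postprocessing_eps_kkt[OF r \<epsilon> x _ post_output(4) k(3,4)])
       (use k in \<open>auto simp: small_step_def\<close>)
  moreover have "real N \<le> total_bound" using inv unfolding post_output(1) by (rule run_inv_Post_count)
  ultimately show ?thesis using post_output by (simp add: multiplier_update_def)
qed

lemma step_exists:
  assumes inv: "run_inv i (N, st)" and run: "\<And>x \<mu>. st \<noteq> Output x \<mu>"
  shows "\<exists>c. step (N, st) c"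
proof (cases st)
  case (Main k \<mu> j x z)
  then have xz: "x \<in> X" "z \<in> X" using inv by (auto simp: inner_inv_def)
  obtain x' z' where "inner_step (smooth_part f g K \<mu> (\<rho> k)) P (lip \<mu> (\<rho> k)) j x z x' z'"
    using inner_step_exists[OF \<rho>_pos xz] by blast
  then show ?thesis unfolding Main using alm_step.intros(1-4) xz(1) by metis
next
  case (Post \<mu> r j x z)
  then have xz: "x \<in> X" "z \<in> X" and r: "0 < r" using inv \<rho>_pos by (auto simp: inner_inv_def)
  obtain x' z' where "inner_step (smooth_part f g K \<mu> r) P (lip \<mu> r) j x z x' z'"
    using inner_step_exists[OF r xz] by blast
  moreover obtain x'' where "prox_grad_step f P g K L_f L_dg L_g M_g \<mu> r x x''"
    using prox_grad_step_exists[OF r xz(1)] by blast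
  ultimately show ?thesis unfolding Post using alm_step.intros(5,6) by metis
qed (use run in auto)

text \<open>As long as there is no output, a transition is possible and the invariant is preserved; but then
  the index of the configuration is bounded by the bounds for the two counters.\<close>

lemma execution_terminates:
  assumes exec: "alm_execution f P g K L_f L_dg L_g M_g \<epsilon> \<rho> \<eta> lam0 \<sigma>"
  shows "\<exists>i N x \<mu>. \<sigma> i = (N, Output x \<mu>) \<and> eps_kkt f P g K \<epsilon> x \<mu> \<and> real N \<le> total_bound"
proof (rule ccontr)
  assume none: "\<not> ?thesis"
  have inv: "run_inv i (\<sigma> i)" for i
  proof (induction i)
    case 0
    from exec obtain s where "s \<in> X" "\<sigma> 0 = (0, Main 0 lam0 0 s s)" by (auto simp: alm_execution_def)
    then show ?case using outer_inv_start inner_inv_start main_bound_ge_1[of 0] by simp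
  next
    case (Suc i)
    obtain N st where s: "\<sigma> i = (N, st)" by fastforce
    have "st \<noteq> Output x \<mu>" for x \<mu> using none Suc s by auto
    then have "\<exists>c. step (\<sigma> i) c" using step_exists Suc s by metis
    then have "step (\<sigma> i) (\<sigma> (Suc i))" using exec unfolding alm_execution_def by meson
    then show ?case using Suc by (rule run_inv_step)
  qed
  define i where "i = nat \<lceil>total_bound + 12 * d ^ 4 * q ^ 4 + 2\<rceil>"
  have i: "total_bound + 12 * d ^ 4 * q ^ 4 + 2 \<le> real i" unfolding i_def by linarith
  obtain N st where s: "\<sigma> i = (N, st)" by fastforce
  show False
  proof (cases st)
    case (Main k \<mu> j x z)
    then have "real N \<le> total_bound" "real k \<le> 12 * d ^ 4 * q ^ 4" "i = N + k"
      using inv[of i] s run_inv_Main_count(2)[of i N k] outer_count by auto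
    then show False using i by simp
  next
    case (Post \<mu> r j x z)
    then have "real N \<le> total_bound" using inv[of i] s run_inv_Post_count by simp
    moreover from Post inv[of i] s obtain k where "real k \<le> 12 * d ^ 4 * q ^ 4" "i = Suc (N + k)"
      using outer_count by auto
    ultimately show False using i by simp
  next
    case (Output x \<mu>)
    then show False using none inv[of i] s by auto
  qed
qed

end

section \<open>Iteration complexity\<close>

theorem theorem2:
  fixes f P :: "'a::euclidean_space \<Rightarrow> ereal"
    and g :: "'a \<Rightarrow> 'b::euclidean_space"
    and K :: "'b set"
    and \<Omega> :: "'a set"
    and L_f L_dg L_g M_g D_X D_\<Lambda> B C \<epsilon> \<rho>0 \<eta>0 :: real
    and lam0 lam_hat :: 'b
    and \<rho> \<eta> :: "nat \<Rightarrow> real"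
    and \<sigma> :: "nat \<Rightarrow> nat \<times> ('a, 'b) alm_state"
  assumes f: "proper_closed_convex f"
    and P: "proper_closed_convex P"
    and K: "closed K" "convex_cone K"
    and g: "cone_convex K g"
    and dom_P: "compact (edom P)"
    and \<Omega>: "open \<Omega>" "edom P \<subseteq> \<Omega>"
    and f_smooth: "cont_diff_fun_on \<Omega> f" "L_f-lipschitz_on \<Omega> (grad f)"
    and g_smooth: "cont_diff_map_on \<Omega> g" "grad_map_lipschitz_on L_dg \<Omega> g"
    and strong_duality: "strong_duality f P g K"
    and L_g: "L_g-lipschitz_on (edom P) g"
    and M_g: "M_g = (SUP x\<in>edom P. norm (g x))"
    and D_X: "D_X = diameter (edom P)"
    and lam0: "lam0 \<in> dual_cone K"
    and lam_hat: "lam_hat \<in> dual_solutions f P g K"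
      "norm (lam0 - lam_hat) = infdist lam0 (dual_solutions f P g K)"
    and D_\<Lambda>: "D_\<Lambda> = norm (lam0 - lam_hat)"
    and B: "B = L_f + L_dg * (norm lam_hat + D_\<Lambda>)"
    and C: "C = L_dg * M_g + L_g\<^sup>2"
    and \<epsilon>: "\<epsilon> > 0"
    and \<rho>0: "\<rho>0 \<ge> 1"
    and \<eta>0: "0 < \<eta>0" "\<eta>0 \<le> 1"
    and \<rho>: "\<And>k. \<rho> k = \<rho>0 * (real k + 1) powr (3/2)"
    and \<eta>: "\<And>k. \<eta> k = \<eta>0 * (real k + 1) powr (-5/2) * min 1 (sqrt \<epsilon>)"
    and execution: "alm_execution f P g K L_f L_dg L_g M_g \<epsilon> \<rho> \<eta> lam0 \<sigma>"
  shows "\<exists>i N x \<mu>. \<sigma> i = (N, Output x \<mu>) \<and> eps_kkt f P g K \<epsilon> x \<mu> \<and>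
           real N \<le> hidden_constant \<rho>0 \<eta>0 *
             complexity_T D_X (max D_\<Lambda> 1) (max B 1) (max C 1) L_dg (min 1 \<epsilon>)"
proof -
  interpret alm_setting f P g K \<Omega> L_f L_dg L_g M_g D_X lam0 lam_hat D_\<Lambda> B C \<epsilon> \<rho>0 \<eta>0 \<rho> \<eta>
    by unfold_locales (fact assms)+
  show ?thesis by (rule execution_terminates[OF execution])
qed

end
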